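(* Let $k$ be an algebraically closed field of characteristic zero and let $q\in k$ be non-zero and not a root of unity. Let $\tau$ be the involutive Hopf algebra automorphism of $U_q(\mathfrak{sl}_2)$ given by $\tau(E)=-E$, $\tau(F)=-F$, $\tau(K)=K$. For every $\ell\in\frac12\mathbb{N}_0$, the $\tau$-twisted Frobenius--Schur indicator of the left $U_q(\mathfrak{sl}_2)$-module $V_\ell$ is $$\nu^\tau(V_\ell)=+1.$$
   Context: $\mathbb{N}_0=\{0,1,2,\dots\}$ and $[n]_q=\frac{q^n-q^{-n}}{q-q^{-1}}$. $U_q(\mathfrak{sl}_2)$ is the Hopf algebra generated as an algebra by $E,F,K,K^{-1}$ with relations $KK^{-1}=1=K^{-1}K$, $KEK^{-1}=q^2E$, $KFK^{-1}=q^{-2}F$, $EF-FE=\frac{K-K^{-1}}{q-q^{-1}}$; $\Delta(K)=K\otimes K$, $\Delta(E)=E\otimes K+1\otimes E$, $\Delta(F)=F\otimes1+K^{-1}\otimes F$; $\varepsilon(K)=1$, $\varepsilon(E)=\varepsilon(F)=0$; $S(K)=K^{-1}$, $S(E)=-EK^{-1}$, $S(F)=-KF$. One has $S^2(u)=KuK^{-1}$ for all $u$. For $\ell\in\frac12\mathbb{N}_0$ let $I_\ell=\{-\ell,-\ell+1,\dots,\ell\}$. The left module $V_\ell$ has basis $\{v_i\}_{i\in I_\ell}$ with action $Kv_i=q^{2i}v_i$, $Ev_i=[\ell+i+1]_qv_{i+1}$, $Fv_i=[\ell-i+1]_qv_{i-1}$, where $v_{\ell+1}=v_{-(\ell+1)}=0$.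 The $\tau$-twisted Frobenius--Schur indicator of a finite-dimensional left module $V$ over $U=U_q(\mathfrak{sl}_2)$ is defined as follows. Let $V^\sharp$ be the dual space $V^\vee$ with left action $\langle uf,v\rangle=\langle f,S(\tau(u))v\rangle$, and let $j_V:V\to V^{\sharp\sharp}$ be the module isomorphism $\langle j_V(v),f\rangle=\langle f,Kv\rangle$. Then $\nu^\tau(V)\in k$ is the trace of the linear map $\mathrm{Hom}_U(V,V^\sharp)\to\mathrm{Hom}_U(V,V^\sharp)$, $f\mapsto f^\vee\circ j_V$, where $f^\vee$ is the transpose of $f$. *)

theory Defs
  imports
    "HOL-Library.Poly_Mapping"
    "HOL-Library.Product_Plus"
    "HOL-Library.Function_Algebras"
    "HOL-Computational_Algebra.Polynomial"
    "HOL-Algebra.QuotRing"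
    "HOL-Algebra.Algebraic_Closure_Type"
begin

section \<open>The free algebra on four letters\<close>

datatype uq_gen = GE | GF | GK | GKinv

datatype uq_word = Word (letters: "uq_gen list")

instantiation uq_word :: monoid_add
begin

definition zero_uq_word :: uq_word
  where "0 = Word []"

definition plus_uq_word :: "uq_word \<Rightarrow> uq_word \<Rightarrow> uq_word"
  where "v + w = Word (letters v @ letters w)"

instance
  by standard (simp_all add: zero_uq_word_def plus_uq_word_def)

end

text \<open>The multiplication of \<open>\<Rightarrow>\<^sub>0\<close> is convolution, so \<open>uq_word \<Rightarrow>\<^sub>0 'k\<close> is the
  monoid algebra of the free monoid. In the same way \<open>uq_word \<times> uq_word \<Rightarrow>\<^sub>0 'k\<close> is the
  monoid algebra of the product monoid, that is, the tensor square of the free algebra.\<close>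

type_synonym 'k free = "uq_word \<Rightarrow>\<^sub>0 'k"
type_synonym 'k free2 = "uq_word \<times> uq_word \<Rightarrow>\<^sub>0 'k"

definition const :: "'k \<Rightarrow> ('w::monoid_add \<Rightarrow>\<^sub>0 'k::field)"
  where "const c = Poly_Mapping.single 0 c"

definition gen :: "uq_gen \<Rightarrow> 'k::field free"
  where "gen x = Poly_Mapping.single (Word [x]) 1"

definition free_hom :: "('k \<Rightarrow> 'a) \<Rightarrow> (uq_gen \<Rightarrow> 'a) \<Rightarrow> 'k::field free \<Rightarrow> 'a::ring_1"
  where "free_hom \<eta> g p =
    (\<Sum>w\<in>Poly_Mapping.keys p. \<eta> (Poly_Mapping.lookup p w) * prod_list (map g (letters w)))"

definition free_antihom :: "('k \<Rightarrow> 'a) \<Rightarrow> (uq_gen \<Rightarrow> 'a) \<Rightarrow> 'k::field free \<Rightarrow> 'a::ring_1"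
  where "free_antihom \<eta> g p =
    (\<Sum>w\<in>Poly_Mapping.keys p. \<eta> (Poly_Mapping.lookup p w) * prod_list (map g (rev (letters w))))"

text \<open>\<open>p \<mapsto> p \<otimes> 1\<close> and \<open>p \<mapsto> 1 \<otimes> p\<close>.\<close>

definition inl :: "'k::field free \<Rightarrow> 'k free2"
  where "inl p = (\<Sum>w\<in>Poly_Mapping.keys p. Poly_Mapping.single (w, 0) (Poly_Mapping.lookup p w))"

definition inr :: "'k::field free \<Rightarrow> 'k free2"
  where "inr p = (\<Sum>w\<in>Poly_Mapping.keys p. Poly_Mapping.single (0, w) (Poly_Mapping.lookup p w))"


section \<open>The Hopf algebra $U_q(\mathfrak{sl}_2)$\<close>

definition uq_rels :: "'k::field \<Rightarrow> 'k free set"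
  where "uq_rels q =
    {gen GK * gen GKinv - 1,
     gen GKinv * gen GK - 1,
     gen GK * gen GE * gen GKinv - const (q ^ 2) * gen GE,
     gen GK * gen GF * gen GKinv - const (inverse q ^ 2) * gen GF,
     gen GE * gen GF - gen GF * gen GE
       - const (1 / (q - inverse q)) * (gen GK - gen GKinv)}"

definition uq_ideal :: "'k::field \<Rightarrow> 'k free set"
  where "uq_ideal q = genideal ring_of_type_algebra (uq_rels q)"

definition Uq :: "'k::field \<Rightarrow> 'k free set ring"
  where "Uq q = ring_of_type_algebra Quot uq_ideal q"

definition uq_class :: "'k::field \<Rightarrow> 'k free \<Rightarrow> 'k free set"
  where "uq_class q p = uq_ideal q +>\<^bsub>ring_of_type_algebra\<^esub> p"

abbreviation uqE :: "'k::field \<Rightarrow> 'k free set" where "uqE q \<equiv> uq_class q (gen GE)"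
abbreviation uqF :: "'k::field \<Rightarrow> 'k free set" where "uqF q \<equiv> uq_class q (gen GF)"
abbreviation uqK :: "'k::field \<Rightarrow> 'k free set" where "uqK q \<equiv> uq_class q (gen GK)"

definition uq_scale :: "'k::field \<Rightarrow> 'k \<Rightarrow> 'k free set \<Rightarrow> 'k free set"
  where "uq_scale q c u = uq_class q (const c) \<otimes>\<^bsub>Uq q\<^esub> u"

text \<open>With \<open>A\<close> the free algebra and \<open>I\<close> the ideal of relations, the kernel of
  \<open>A \<otimes> A \<rightarrow> A/I \<otimes> A/I\<close> is \<open>I \<otimes> A + A \<otimes> I\<close>, the ideal generated by \<open>I \<otimes> 1\<close> and \<open>1 \<otimes> I\<close>.\<close>

definition uq2_ideal :: "'k::field \<Rightarrow> 'k free2 set"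
  where "uq2_ideal q = genideal ring_of_type_algebra (inl ` uq_ideal q \<union> inr ` uq_ideal q)"

definition Uq2 :: "'k::field \<Rightarrow> 'k free2 set ring"
  where "Uq2 q = ring_of_type_algebra Quot uq2_ideal q"

definition uq2_class :: "'k::field \<Rightarrow> 'k free2 \<Rightarrow> 'k free2 set"
  where "uq2_class q p = uq2_ideal q +>\<^bsub>ring_of_type_algebra\<^esub> p"

text \<open>Maps out of a quotient are defined by evaluating at a representative of the coset; that
  the result does not depend on it is proved below.\<close>

definition coset_rep :: "'a set \<Rightarrow> 'a"
  where "coset_rep u = (SOME x. x \<in> u)"

definition uq_tensor :: "'k::field \<Rightarrow> 'k free set \<Rightarrow> 'k free set \<Rightarrow> 'k free2 set"
  where "uq_tensor q u v = uq2_class q (inl (coset_rep u) * inr (coset_rep v))"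

fun comult_gen :: "uq_gen \<Rightarrow> 'k::field free2" where
  "comult_gen GE = inl (gen GE) * inr (gen GK) + inr (gen GE)"
| "comult_gen GF = inl (gen GF) + inl (gen GKinv) * inr (gen GF)"
| "comult_gen GK = inl (gen GK) * inr (gen GK)"
| "comult_gen GKinv = inl (gen GKinv) * inr (gen GKinv)"

fun counit_gen :: "uq_gen \<Rightarrow> 'k::field" where
  "counit_gen GE = 0"
| "counit_gen GF = 0"
| "counit_gen GK = 1"
| "counit_gen GKinv = 1"

fun antipode_gen :: "uq_gen \<Rightarrow> 'k::field free" where
  "antipode_gen GE = - (gen GE * gen GKinv)"
| "antipode_gen GF = - (gen GK * gen GF)"
| "antipode_gen GK = gen GKinv"
| "antipode_gen GKinv = gen GK"

definition uq_comult :: "'k::field \<Rightarrow> 'k free set \<Rightarrow> 'k free2 set"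
  where "uq_comult q u = uq2_class q (free_hom const comult_gen (coset_rep u))"

definition uq_counit :: "'k::field \<Rightarrow> 'k free set \<Rightarrow> 'k"
  where "uq_counit q u = free_hom id counit_gen (coset_rep u)"

definition uq_antipode :: "'k::field \<Rightarrow> 'k free set \<Rightarrow> 'k free set"
  where "uq_antipode q u = uq_class q (free_antihom const antipode_gen (coset_rep u))"

text \<open>Compatibility with the comultiplication, \<open>\<Delta> \<circ> \<tau> = (\<tau> \<otimes> \<tau>) \<circ> \<Delta>\<close>, is expressed through
  expansions \<open>\<Delta> u = \<Sum>\<^sub>i a\<^sub>i \<otimes> b\<^sub>i\<close>.\<close>

definition hopf_automorphism :: "'k::field \<Rightarrow> ('k free set \<Rightarrow> 'k free set) \<Rightarrow> bool"
  where "hopf_automorphism q \<tau> \<longleftrightarrow>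
    \<tau> \<in> ring_iso (Uq q) (Uq q) \<and>
    (\<forall>c. \<forall>u\<in>carrier (Uq q). \<tau> (uq_scale q c u) = uq_scale q c (\<tau> u)) \<and>
    (\<forall>u\<in>carrier (Uq q). \<forall>n::nat. \<forall>a b.
       a \<in> {..<n} \<rightarrow> carrier (Uq q) \<longrightarrow> b \<in> {..<n} \<rightarrow> carrier (Uq q) \<longrightarrow>
       uq_comult q u = (\<Oplus>\<^bsub>Uq2 q\<^esub>i\<in>{..<n}. uq_tensor q (a i) (b i)) \<longrightarrow>
       uq_comult q (\<tau> u) = (\<Oplus>\<^bsub>Uq2 q\<^esub>i\<in>{..<n}. uq_tensor q (\<tau> (a i)) (\<tau> (b i)))) \<and>
    (\<forall>u\<in>carrier (Uq q). uq_counit q (\<tau> u) = uq_counit q u) \<and>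
    (\<forall>u\<in>carrier (Uq q). uq_antipode q (\<tau> u) = \<tau> (uq_antipode q u))"


section \<open>Modules and the twisted Frobenius--Schur indicator\<close>

text \<open>A vector space is a subset \<open>vec\<close> of a type, closed under the operations of the type and the
  scaling \<open>smul\<close>. A linear map defined on \<open>vec\<close> is represented by the function that is \<open>0\<close>
  outside \<open>vec\<close>, so that equal maps are equal as functions.\<close>

record ('k, 'v) vspace =
  vec :: "'v set"
  smul :: "'k \<Rightarrow> 'v \<Rightarrow> 'v"

record (overloaded) ('k::zero, 'v) umodule = "('k, 'v) vspace" +
  act :: "'k free set \<Rightarrow> 'v \<Rightarrow> 'v"

definition left_module :: "'k::field \<Rightarrow> ('k, 'v::ab_group_add) umodule \<Rightarrow> bool"
  where "left_module q V \<longleftrightarrow>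
    vector_space (smul V) \<and> Modules.module.subspace (smul V) (vec V) \<and>
    (\<forall>u\<in>carrier (Uq q). \<forall>v\<in>vec V. act V u v \<in> vec V) \<and>
    (\<forall>u\<in>carrier (Uq q). \<forall>v\<in>vec V. \<forall>w\<in>vec V. act V u (v + w) = act V u v + act V u w) \<and>
    (\<forall>u\<in>carrier (Uq q). \<forall>v\<in>vec V. \<forall>c. act V u (smul V c v) = smul V c (act V u v)) \<and>
    (\<forall>u\<in>carrier (Uq q). \<forall>u'\<in>carrier (Uq q). \<forall>v\<in>vec V.
       act V (u \<oplus>\<^bsub>Uq q\<^esub> u') v = act V u v + act V u' v) \<and>
    (\<forall>u\<in>carrier (Uq q). \<forall>u'\<in>carrier (Uq q). \<forall>v\<in>vec V.
       act V (u \<otimes>\<^bsub>Uq q\<^esub> u') v = act V u (act V u' v)) \<and>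
    (\<forall>c. \<forall>u\<in>carrier (Uq q). \<forall>v\<in>vec V. act V (uq_scale q c u) v = smul V c (act V u v)) \<and>
    (\<forall>v\<in>vec V. act V \<one>\<^bsub>Uq q\<^esub> v = v)"

definition linear_maps ::
  "('k, 'v::ab_group_add, 'x) vspace_scheme \<Rightarrow> ('k, 'w::ab_group_add, 'y) vspace_scheme
     \<Rightarrow> ('v \<Rightarrow> 'w) set"
  where "linear_maps V W = {f.
    (\<forall>v\<in>vec V. f v \<in> vec W) \<and>
    (\<forall>v\<in>vec V. \<forall>w\<in>vec V. f (v + w) = f v + f w) \<and>
    (\<forall>c. \<forall>v\<in>vec V. f (smul V c v) = smul W c (f v)) \<and>
    (\<forall>v. v \<notin> vec V \<longrightarrow> f v = 0)}"

definition ground :: "('k::field, 'k) vspace"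
  where "ground = \<lparr>vec = UNIV, smul = (*)\<rparr>"

definition dual_space :: "('k::field, 'v::ab_group_add, 'x) vspace_scheme \<Rightarrow> ('k, 'v \<Rightarrow> 'k) vspace"
  where "dual_space V = \<lparr>vec = linear_maps V ground, smul = (\<lambda>c f v. c * f v)\<rparr>"

definition transpose_map ::
  "('k::field, 'v::ab_group_add, 'x) vspace_scheme \<Rightarrow> ('k, 'w::ab_group_add, 'y) vspace_scheme
     \<Rightarrow> ('v \<Rightarrow> 'w) \<Rightarrow> ('w \<Rightarrow> 'k) \<Rightarrow> ('v \<Rightarrow> 'k)"
  where "transpose_map V W f =
    (\<lambda>\<phi>. if \<phi> \<in> vec (dual_space W) then (\<lambda>v. if v \<in> vec V then \<phi> (f v) else 0) else 0)"

definition module_hom_space ::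
  "'k::field \<Rightarrow> ('k, 'v::ab_group_add) umodule \<Rightarrow> ('k, 'w::ab_group_add) umodule
     \<Rightarrow> ('k, 'v \<Rightarrow> 'w) vspace"
  where "module_hom_space q V W =
    \<lparr>vec = {f \<in> linear_maps V W.
       \<forall>u\<in>carrier (Uq q). \<forall>v\<in>vec V. f (act V u v) = act W u (f v)},
     smul = (\<lambda>c f v. smul W c (f v))\<rparr>"

definition space_trace :: "('k::field, 'v::ab_group_add) vspace \<Rightarrow> ('v \<Rightarrow> 'v) \<Rightarrow> 'k"
  where "space_trace V T =
    (let B = (SOME B. B \<subseteq> vec V \<and> \<not> Modules.module.dependent (smul V) B \<and>
                      Modules.module.span (smul V) B = vec V)
     in \<Sum>b\<in>B. Modules.module.representation (smul V) B (T b) b)"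

definition sharp ::
  "'k::field \<Rightarrow> ('k free set \<Rightarrow> 'k free set) \<Rightarrow> ('k, 'v::ab_group_add) umodule
     \<Rightarrow> ('k, 'v \<Rightarrow> 'k) umodule"
  where "sharp q \<tau> V =
    \<lparr>vec = vec (dual_space V),
     smul = smul (dual_space V),
     act = (\<lambda>u f v. if v \<in> vec V then f (act V (uq_antipode q (\<tau> u)) v) else 0)\<rparr>"

definition double_sharp_map ::
  "'k::field \<Rightarrow> ('k free set \<Rightarrow> 'k free set) \<Rightarrow> ('k, 'v::ab_group_add) umodule
     \<Rightarrow> 'v \<Rightarrow> ('v \<Rightarrow> 'k) \<Rightarrow> 'k"
  where "double_sharp_map q \<tau> V =
    (\<lambda>v. if v \<in> vec V
         then (\<lambda>f. if f \<in> vec (sharp q \<tau> V) then f (act V (uqK q) v) else 0)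
         else 0)"

definition twisted_indicator ::
  "'k::field \<Rightarrow> ('k free set \<Rightarrow> 'k free set) \<Rightarrow> ('k, 'v::ab_group_add) umodule \<Rightarrow> 'k"
  where "twisted_indicator q \<tau> V =
    space_trace (module_hom_space q V (sharp q \<tau> V))
      (\<lambda>f. transpose_map V (sharp q \<tau> V) f \<circ> double_sharp_map q \<tau> V)"


section \<open>The modules $V_\ell$\<close>

definition qint :: "'k::field \<Rightarrow> int \<Rightarrow> 'k"
  where "qint q n = (q powi n - q powi (- n)) / (q - inverse q)"

definition weights :: "rat \<Rightarrow> rat set"
  where "weights l = {i. - l \<le> i \<and> i \<le> l \<and> i + l \<in> \<int>}"

text \<open>$V_\ell$ consists of the functions \<open>rat \<Rightarrow> 'k\<close> supported on \<open>weights l\<close>.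
  Note that \<open>basis_vec l i = 0\<close> for \<open>i\<close> outside \<open>weights l\<close>, in particular for
  \<open>i = l + 1\<close> and \<open>i = - (l + 1)\<close>. All the rationals under \<open>\<lfloor>_\<rfloor>\<close> are integers when
  \<open>i \<in> weights l\<close> and \<open>2 * l\<close> is an integer.\<close>

definition basis_vec :: "rat \<Rightarrow> rat \<Rightarrow> (rat \<Rightarrow> 'k::field)"
  where "basis_vec l i = (\<lambda>j. if j = i \<and> i \<in> weights l then 1 else 0)"

definition fun_scale :: "'k::field \<Rightarrow> ('i \<Rightarrow> 'k) \<Rightarrow> 'i \<Rightarrow> 'k"
  where "fun_scale c f = (\<lambda>i. c * f i)"

fun gen_on_basis :: "'k::field \<Rightarrow> rat \<Rightarrow> uq_gen \<Rightarrow> rat \<Rightarrow> (rat \<Rightarrow> 'k)" where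
  "gen_on_basis q l GE i = fun_scale (qint q \<lfloor>l + i + 1\<rfloor>) (basis_vec l (i + 1))"
| "gen_on_basis q l GF i = fun_scale (qint q \<lfloor>l - i + 1\<rfloor>) (basis_vec l (i - 1))"
| "gen_on_basis q l GK i = fun_scale (q powi \<lfloor>2 * i\<rfloor>) (basis_vec l i)"
| "gen_on_basis q l GKinv i = fun_scale (q powi (- \<lfloor>2 * i\<rfloor>)) (basis_vec l i)"

definition gen_act :: "'k::field \<Rightarrow> rat \<Rightarrow> uq_gen \<Rightarrow> (rat \<Rightarrow> 'k) \<Rightarrow> (rat \<Rightarrow> 'k)"
  where "gen_act q l x f = (\<Sum>i\<in>weights l. fun_scale (f i) (gen_on_basis q l x i))"

definition free_act :: "'k::field \<Rightarrow> rat \<Rightarrow> 'k free \<Rightarrow> (rat \<Rightarrow> 'k) \<Rightarrow> (rat \<Rightarrow> 'k)"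
  where "free_act q l p f =
    (\<Sum>w\<in>Poly_Mapping.keys p.
       fun_scale (Poly_Mapping.lookup p w) (foldr (gen_act q l) (letters w) f))"

definition Vmod :: "'k::field \<Rightarrow> rat \<Rightarrow> ('k, rat \<Rightarrow> 'k) umodule"
  where "Vmod q l =
    \<lparr>vec = {f. \<forall>i. i \<notin> weights l \<longrightarrow> f i = 0},
     smul = fun_scale,
     act = (\<lambda>u. free_act q l (coset_rep u))\<rparr>"


section \<open>Independence of representatives\<close>

abbreviation (input) "tra \<equiv> ring_of_type_algebra"

lemma carrier_tra [simp]: "carrier tra = UNIV"
  and mult_tra [simp]: "x \<otimes>\<^bsub>tra\<^esub> y = x * y"
  and one_tra [simp]: "\<one>\<^bsub>tra\<^esub> = 1"
  and zero_tra [simp]: "\<zero>\<^bsub>tra\<^esub> = 0"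
  and add_tra [simp]: "x \<oplus>\<^bsub>tra\<^esub> y = x + y"
  by (simp_all add: ring_of_type_algebra_def)

lemma ring_tra: "ring (ring_of_type_algebra :: 'a::ring_1 ring)"
proof -
  have "\<exists>y. x + y = 0" for x :: 'a
    using add.right_inverse by blast
  thus ?thesis
    unfolding ring_of_type_algebra_def
    by unfold_locales (auto simp: algebra_simps Units_def add_eq_0_iff)
qed

lemma minus_tra [simp]: "\<ominus>\<^bsub>tra\<^esub> x = - (x::'a::ring_1)"
proof -
  interpret ring "ring_of_type_algebra :: 'a ring" by (rule ring_tra)
  show ?thesis by (rule minus_equality) auto
qed

lemma ideal_traI:
  fixes I :: "'a::ring_1 set"
  assumes "0 \<in> I" "\<And>x y. x \<in> I \<Longrightarrow> y \<in> I \<Longrightarrow> x + y \<in> I"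
    "\<And>x y. x \<in> I \<Longrightarrow> y * x \<in> I" "\<And>x y. x \<in> I \<Longrightarrow> x * y \<in> I"
  shows "ideal I ring_of_type_algebra"
proof (rule idealI[OF ring_tra])
  interpret ring "ring_of_type_algebra :: 'a ring" by (rule ring_tra)
  have "- x \<in> I" if "x \<in> I" for x using assms(3)[OF that, of "-1"] by simp
  hence inv: "\<ominus>\<^bsub>tra\<^esub> x \<in> I" if "x \<in> I" for x using that by simp
  show "subgroup I (add_monoid ring_of_type_algebra)"
  proof (rule add.subgroupI)
    show "I \<noteq> {}" using assms(1) by blast
  next
    fix x y assume "x \<in> I" "y \<in> I"
    thus "x \<oplus>\<^bsub>tra\<^esub> y \<in> I" using assms(2) by simp
  next
    fix x assume "x \<in> I"
    thus "\<ominus>\<^bsub>tra\<^esub> x \<in> I" by (rule inv)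
  qed simp
qed (use assms in auto)

lemma ideal_traD:
  fixes I :: "'a::ring_1 set"
  assumes "ideal I ring_of_type_algebra"
  shows "0 \<in> I" "\<And>x y. x \<in> I \<Longrightarrow> y \<in> I \<Longrightarrow> x + y \<in> I" "\<And>x y. x \<in> I \<Longrightarrow> y \<in> I \<Longrightarrow> x - y \<in> I"
    "\<And>x y. x \<in> I \<Longrightarrow> y * x \<in> I" "\<And>x y. x \<in> I \<Longrightarrow> x * y \<in> I" "\<And>x. x \<in> I \<Longrightarrow> - x \<in> I"
proof -
  interpret ideal I "ring_of_type_algebra :: 'a ring" by (rule assms)
  show "0 \<in> I" using additive_subgroup.zero_closed[OF ideal.axioms(1)[OF assms]] by simp
  show *: "x + y \<in> I" if "x \<in> I" "y \<in> I" for x y using additive_subgroup.a_closed[OF ideal.axioms(1)[OF assms] that] by simp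
  show l: "y * x \<in> I" if "x \<in> I" for x y using I_l_closed[OF that, of y] by simp
  show "x * y \<in> I" if "x \<in> I" for x y using I_r_closed[OF that, of y] by simp
  show m: "- x \<in> I" if "x \<in> I" for x using l[OF that, of "-1"] by simp
  show "x - y \<in> I" if "x \<in> I" "y \<in> I" for x y using *[OF that(1) m[OF that(2)]] by simp
qed

lemma coset_tra: "I +>\<^bsub>tra\<^esub> x = {y + x | y. y \<in> I}"
  by (auto simp: a_r_coset_def')

lemma coset_tra_eq_iff:
  fixes I :: "'a::ring_1 set"
  assumes "ideal I ring_of_type_algebra"
  shows "I +>\<^bsub>tra\<^esub> x = I +>\<^bsub>tra\<^esub> y \<longleftrightarrow> x - y \<in> I"
proof
  note I = ideal_traD[OF assms]
  assume "I +>\<^bsub>tra\<^esub> x = I +>\<^bsub>tra\<^esub> y"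
  moreover have "x \<in> I +>\<^bsub>tra\<^esub> x" unfolding coset_tra using I(1) by force
  ultimately show "x - y \<in> I" unfolding coset_tra by auto
next
  note I = ideal_traD[OF assms]
  assume *: "x - y \<in> I"
  have "z + x = (z + (x - y)) + y" "z + y = (z - (x - y)) + x" for z by simp_all
  thus "I +>\<^bsub>tra\<^esub> x = I +>\<^bsub>tra\<^esub> y" unfolding coset_tra using I(2)[OF _ *] I(3)[OF _ *] by blast
qed

lemma coset_rep_diff:
  fixes I :: "'a::ring_1 set"
  assumes "ideal I ring_of_type_algebra"
  shows "coset_rep (I +>\<^bsub>tra\<^esub> x) - x \<in> I"
proof -
  have "x \<in> I +>\<^bsub>tra\<^esub> x" unfolding coset_tra using ideal_traD(1)[OF assms] by force
  hence "coset_rep (I +>\<^bsub>tra\<^esub> x) \<in> I +>\<^bsub>tra\<^esub> x" unfolding coset_rep_def by (rule someI)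
  thus ?thesis unfolding coset_tra by auto
qed

lemma ideal_uq: "ideal (uq_ideal q) ring_of_type_algebra"
  unfolding uq_ideal_def by (rule ring.genideal_ideal[OF ring_tra]) simp

lemma ideal_uq2: "ideal (uq2_ideal q) ring_of_type_algebra"
  unfolding uq2_ideal_def by (rule ring.genideal_ideal[OF ring_tra]) simp

lemma uq_class_eq_iff: "uq_class q x = uq_class q y \<longleftrightarrow> x - y \<in> uq_ideal q"
  unfolding uq_class_def by (rule coset_tra_eq_iff[OF ideal_uq])

lemma uq2_class_eq_iff: "uq2_class q x = uq2_class q y \<longleftrightarrow> x - y \<in> uq2_ideal q"
  unfolding uq2_class_def by (rule coset_tra_eq_iff[OF ideal_uq2])

lemma carrier_Uq: "carrier (Uq q) = range (uq_class q)"
  unfolding Uq_def FactRing_def uq_class_def by (auto simp: A_RCOSETS_def')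

lemma carrier_Uq2: "carrier (Uq2 q) = range (uq2_class q)"
  unfolding Uq2_def FactRing_def uq2_class_def by (auto simp: A_RCOSETS_def')

lemma ring_Uq: "ring (Uq q)" unfolding Uq_def by (rule ideal.quotient_is_ring[OF ideal_uq])
lemma ring_Uq2: "ring (Uq2 q)" unfolding Uq2_def by (rule ideal.quotient_is_ring[OF ideal_uq2])

lemma uq_class_hom: "uq_class q \<in> ring_hom ring_of_type_algebra (Uq q)"
  unfolding Uq_def uq_class_def using ideal.rcos_ring_hom[OF ideal_uq] .
lemma uq2_class_hom: "uq2_class q \<in> ring_hom ring_of_type_algebra (Uq2 q)"
  unfolding Uq2_def uq2_class_def using ideal.rcos_ring_hom[OF ideal_uq2] .

lemma uq_class_simps:
  "uq_class q (x * y) = uq_class q x \<otimes>\<^bsub>Uq q\<^esub> uq_class q y"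
  "uq_class q (x + y) = uq_class q x \<oplus>\<^bsub>Uq q\<^esub> uq_class q y"
  "uq_class q 1 = \<one>\<^bsub>Uq q\<^esub>"
  using ring_hom_mult[OF uq_class_hom, of x y] ring_hom_add[OF uq_class_hom, of x y]
    ring_hom_one[OF uq_class_hom] by simp_all

lemma uq_class_uminus: "uq_class q (- x) = \<ominus>\<^bsub>Uq q\<^esub> uq_class q x"
proof -
  interpret ring_hom_ring ring_of_type_algebra "Uq q" "uq_class q"
    by (rule ring_hom_ringI2[OF ring_tra ring_Uq uq_class_hom])
  show ?thesis using hom_a_inv[of x] by simp
qed

lemma uq_ideal_minimal:
  assumes "ideal J ring_of_type_algebra" "uq_rels q \<subseteq> J" "x \<in> uq_ideal q" shows "x \<in> J"
  using assms ring.genideal_minimal[OF ring_tra] unfolding uq_ideal_def by blast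

lemma uq2_ideal_minimal:
  assumes "ideal J ring_of_type_algebra" "inl ` uq_ideal q \<subseteq> J" "inr ` uq_ideal q \<subseteq> J" 
    "x \<in> uq2_ideal q" shows "x \<in> J"
  using assms ring.genideal_minimal[OF ring_tra, of J "inl ` uq_ideal q \<union> inr ` uq_ideal q"] unfolding uq2_ideal_def by blast

lemma uq_rels_ideal: "uq_rels q \<subseteq> uq_ideal q"
  unfolding uq_ideal_def by (rule ring.genideal_self[OF ring_tra]) simp

lemma uq2_gens_ideal: "x \<in> uq_ideal q \<Longrightarrow> inl x \<in> uq2_ideal q" "x \<in> uq_ideal q \<Longrightarrow> inr x \<in> uq2_ideal q"
  unfolding uq2_ideal_def using ring.genideal_self[OF ring_tra, of "inl ` uq_ideal q \<union> inr ` uq_ideal q"] by auto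

lemma keys_sum_add:
  fixes h :: "'w \<Rightarrow> 'k::field \<Rightarrow> 'a::ab_group_add"
  assumes "\<And>w. h w 0 = 0" "\<And>w a b. h w (a + b) = h w a + h w b"
  shows "(\<Sum>w\<in>Poly_Mapping.keys (p + r). h w (Poly_Mapping.lookup (p + r) w)) =
    (\<Sum>w\<in>Poly_Mapping.keys p. h w (Poly_Mapping.lookup p w)) + (\<Sum>w\<in>Poly_Mapping.keys r. h w (Poly_Mapping.lookup r w))"
proof -
  let ?K = "Poly_Mapping.keys p \<union> Poly_Mapping.keys r"
  have *: "(\<Sum>w\<in>Poly_Mapping.keys s. h w (Poly_Mapping.lookup s w)) = (\<Sum>w\<in>?K. h w (Poly_Mapping.lookup s w))"
    if "Poly_Mapping.keys s \<subseteq> ?K" for s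
    by (rule sum.mono_neutral_left) (use that in \<open>auto simp: assms in_keys_iff\<close>)
  have "Poly_Mapping.keys (p + r) \<subseteq> ?K" by (rule Poly_Mapping.keys_add)
  from *[OF this] *[of p] *[of r] show ?thesis by (simp add: lookup_add assms sum.distrib)
qed

lemma pm_induct [case_names zero add single]:
  fixes p :: "'w \<Rightarrow>\<^sub>0 'k::field"
  assumes "P 0" "\<And>x y. P x \<Longrightarrow> P y \<Longrightarrow> P (x + y)" "\<And>w c. P (Poly_Mapping.single w c)"
  shows "P p"
proof -
  have "p = (\<Sum>w\<in>Poly_Mapping.keys p. Poly_Mapping.single w (Poly_Mapping.lookup p w))"
    by (rule poly_mapping_eqI) (auto simp: lookup_sum lookup_single when_def in_keys_iff)
  moreover have "finite A \<Longrightarrow> P (\<Sum>w\<in>A. Poly_Mapping.single w (Poly_Mapping.lookup p w))" for A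
    by (induction A rule: finite_induct) (auto intro: assms)
  ultimately show ?thesis using finite_keys by metis
qed

lemma inl_add: "inl (p + r) = inl p + inl r"
  unfolding inl_def by (rule keys_sum_add) (auto simp: single_add)
lemma inr_add: "inr (p + r) = inr p + inr r"
  unfolding inr_def by (rule keys_sum_add) (auto simp: single_add)
lemma inl_single [simp]: "inl (Poly_Mapping.single w c) = Poly_Mapping.single (w, 0) c" by (simp add: inl_def)
lemma inr_single [simp]: "inr (Poly_Mapping.single w c) = Poly_Mapping.single (0, w) c" by (simp add: inr_def)
lemma inl_0 [simp]: "inl 0 = 0" by (simp add: inl_def)
lemma inr_0 [simp]: "inr 0 = 0" by (simp add: inr_def)

lemma uq_mult_induct:
  fixes p r :: "('w::monoid_add) \<Rightarrow>\<^sub>0 'k::field"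
  assumes add: "\<And>x y. f (x + y) = f x + (f y :: 'a :: ring_1)"
   and s: "\<And>v w a b. f (Poly_Mapping.single v a * Poly_Mapping.single w b) = f (Poly_Mapping.single v a) * f (Poly_Mapping.single w b)"
  shows "f (p * r) = f p * f r"
proof -
  have f0: "f 0 = 0" using add[of 0 0] by simp
  have 1: "f (Poly_Mapping.single v a * r) = f (Poly_Mapping.single v a) * f r" for v a r
    by (induction r rule: pm_induct) (auto simp: f0 add s algebra_simps)
  show ?thesis by (induction p rule: pm_induct) (auto simp: f0 add 1 algebra_simps)
qed

lemma uq_antimult_induct:
  fixes p r :: "('w::monoid_add) \<Rightarrow>\<^sub>0 'k::field"
  assumes add: "\<And>x y. f (x + y) = f x + (f y :: 'a :: ring_1)"
   and s: "\<And>v w a b. f (Poly_Mapping.single v a * Poly_Mapping.single w b) = f (Poly_Mapping.single w b) * f (Poly_Mapping.single v a)"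
  shows "f (p * r) = f r * f p"
proof -
  have f0: "f 0 = 0" using add[of 0 0] by simp
  have 1: "f (Poly_Mapping.single v a * r) = f r * f (Poly_Mapping.single v a)" for v a r
    by (induction r rule: pm_induct) (auto simp: f0 add s algebra_simps)
  show ?thesis by (induction p rule: pm_induct) (auto simp: f0 add 1 algebra_simps)
qed

lemma inl_mult: "inl (p * r) = inl p * inl r"
  by (rule uq_mult_induct) (auto simp: inl_add mult_single)
lemma inr_mult: "inr (p * r) = inr p * inr r"
  by (rule uq_mult_induct) (auto simp: inr_add mult_single)
lemma inl_inr_commute: "inr p * inl r = inl r * inr p"
proof (induction p rule: pm_induct)
  case (single w c)
  show ?case by (induction r rule: pm_induct) (auto simp: inl_add mult_single algebra_simps)
qed (auto simp: inr_add algebra_simps)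

lemma inl_const [simp]: "inl (const c) = const c" and inr_const [simp]: "inr (const c) = const c"
  by (simp_all add: const_def zero_prod_def)

lemma const_simps:
  "const (a + b) = const a + const b" "const (a * b) = const a * const b" "const 0 = 0" "const 1 = 1"
  "const (- a) = - const a"
  by (simp_all add: const_def single_add mult_single single_uminus)

lemma const_commute: "const c * p = p * const (c :: 'k::field)"
  by (induction p rule: pm_induct) (auto simp: const_def mult_single algebra_simps)

locale scalars =
  fixes \<eta> :: "'k::field \<Rightarrow> 'a::ring_1"
  assumes add: "\<eta> (a + b) = \<eta> a + \<eta> b" and mult: "\<eta> (a * b) = \<eta> a * \<eta> b" and one: "\<eta> 1 = 1"
    and comm: "\<eta> c * x = x * \<eta> c"
begin

lemma zero: "\<eta> 0 = 0" using add[of 0 0] by simp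

lemma hom_add: "free_hom \<eta> g (p + r) = free_hom \<eta> g p + free_hom \<eta> g r"
  unfolding free_hom_def by (rule keys_sum_add) (auto simp: add zero algebra_simps)
lemma anti_add: "free_antihom \<eta> g (p + r) = free_antihom \<eta> g p + free_antihom \<eta> g r"
  unfolding free_antihom_def by (rule keys_sum_add) (auto simp: add zero algebra_simps)

lemma hom_single: "free_hom \<eta> g (Poly_Mapping.single w c) = \<eta> c * prod_list (map g (letters w))"
  unfolding free_hom_def by (auto simp: zero)
lemma anti_single: "free_antihom \<eta> g (Poly_Mapping.single w c) = \<eta> c * prod_list (map g (rev (letters w)))"
  unfolding free_antihom_def by (auto simp: zero)

lemma hom_mult: "free_hom \<eta> g (p * r) = free_hom \<eta> g p * free_hom \<eta> g r"
  by (rule uq_mult_induct)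
    (auto simp: hom_add hom_single mult_single mult plus_uq_word_def, metis comm mult.assoc)
lemma anti_mult: "free_antihom \<eta> g (p * r) = free_antihom \<eta> g r * free_antihom \<eta> g p"
  by (rule uq_antimult_induct)
    (auto simp: anti_add anti_single mult_single mult plus_uq_word_def, metis comm mult.assoc)

lemma hom_const: "free_hom \<eta> g (const c) = \<eta> c"
  by (simp add: const_def hom_single zero_uq_word_def)
lemma anti_const: "free_antihom \<eta> g (const c) = \<eta> c"
  by (simp add: const_def anti_single zero_uq_word_def)
lemma hom_gen: "free_hom \<eta> g (gen x) = g x" by (simp add: gen_def hom_single one)
lemma anti_gen: "free_antihom \<eta> g (gen x) = g x" by (simp add: gen_def anti_single one)
lemma hom_one: "free_hom \<eta> g 1 = 1" using hom_const[of g 1] by (simp add: const_simps one)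
lemma anti_one: "free_antihom \<eta> g 1 = 1" using anti_const[of g 1] by (simp add: const_simps one)
lemma hom_zero: "free_hom \<eta> g 0 = 0" using hom_const[of g 0] by (simp add: const_simps zero)
lemma anti_zero: "free_antihom \<eta> g 0 = 0" using anti_const[of g 0] by (simp add: const_simps zero)
lemma hom_uminus: "free_hom \<eta> g (- p) = - free_hom \<eta> g p"
  using hom_add[of g p "- p"] by (simp add: hom_zero eq_neg_iff_add_eq_0 add.commute)
lemma anti_uminus: "free_antihom \<eta> g (- p) = - free_antihom \<eta> g p"
  using anti_add[of g p "- p"] by (simp add: anti_zero eq_neg_iff_add_eq_0 add.commute)
lemma hom_diff: "free_hom \<eta> g (p - r) = free_hom \<eta> g p - free_hom \<eta> g r"
  using hom_add[of g p "- r"] by (simp add: hom_uminus)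
lemma anti_diff: "free_antihom \<eta> g (p - r) = free_antihom \<eta> g p - free_antihom \<eta> g r"
  using anti_add[of g p "- r"] by (simp add: anti_uminus)

lemmas hom_simps = hom_add hom_mult hom_const hom_gen hom_one hom_zero hom_uminus hom_diff
lemmas anti_simps = anti_add anti_mult anti_const anti_gen anti_one anti_zero anti_uminus anti_diff

lemma hom_unique:
  assumes "\<And>x y. f (x + y) = f x + f y" "\<And>x y. f (x * y) = f x * f y" "\<And>c. f (const c) = \<eta> c"
    "\<And>x. f (gen x) = g x"
  shows "f p = free_hom \<eta> g p"
proof (induction p rule: pm_induct)
  case zero show ?case using assms(1)[of 0 0] by (simp add: hom_zero)
next
  case (single w c)
  have "f (Poly_Mapping.single (Word xs) 1) = prod_list (map g xs)" for xs
  proof (induction xs)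
    case Nil thus ?case using assms(3)[of 1] by (simp add: const_def one zero_uq_word_def)
  next
    case (Cons x xs)
    have "Poly_Mapping.single (Word (x # xs)) (1::'k) = gen x * Poly_Mapping.single (Word xs) 1"
      by (simp add: gen_def mult_single plus_uq_word_def)
    thus ?case by (simp add: assms Cons.IH)
  qed
  moreover have "Poly_Mapping.single w c = const c * Poly_Mapping.single w 1"
    by (simp add: const_def mult_single)
  ultimately show ?case by (metis assms(2,3) hom_single uq_word.collapse)
qed (simp_all add: assms hom_add)

lemma anti_unique:
  assumes "\<And>x y. f (x + y) = f x + f y" "\<And>x y. f (x * y) = f y * f x" "\<And>c. f (const c) = \<eta> c"
    "\<And>x. f (gen x) = g x"
  shows "f p = free_antihom \<eta> g p"
proof (induction p rule: pm_induct)
  case zero show ?case using assms(1)[of 0 0] by (simp add: anti_zero)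
next
  case (single w c)
  have "f (Poly_Mapping.single (Word xs) 1) = prod_list (map g (rev xs))" for xs
  proof (induction xs)
    case Nil thus ?case using assms(3)[of 1] by (simp add: const_def one zero_uq_word_def)
  next
    case (Cons x xs)
    have "Poly_Mapping.single (Word (x # xs)) (1::'k) = gen x * Poly_Mapping.single (Word xs) 1"
      by (simp add: gen_def mult_single plus_uq_word_def)
    thus ?case by (simp add: assms Cons.IH)
  qed
  moreover have "Poly_Mapping.single w c = const c * Poly_Mapping.single w 1"
    by (simp add: const_def mult_single)
  ultimately show ?case by (metis assms(2,3) anti_single comm uq_word.collapse)
qed (simp_all add: assms anti_add)

end

interpretation const_sc: scalars "const :: 'k::field \<Rightarrow> ('w::monoid_add \<Rightarrow>\<^sub>0 'k)"
  by unfold_locales (simp_all add: const_simps, rule const_commute)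
interpretation id_sc: scalars "id :: 'k::field \<Rightarrow> 'k"
  by unfold_locales auto

lemma (in scalars) hom_vanish:
  assumes J: "ideal J ring_of_type_algebra" and "\<And>x. x \<in> uq_rels q \<Longrightarrow> free_hom \<eta> g x \<in> J"
    and "x \<in> uq_ideal q"
  shows "free_hom \<eta> g x \<in> J"
proof -
  have "ideal {x. free_hom \<eta> g x \<in> J} ring_of_type_algebra"
    by (rule ideal_traI) (auto simp: hom_simps ideal_traD[OF J])
  from uq_ideal_minimal[OF this] assms show ?thesis by blast
qed

lemma (in scalars) anti_vanish:
  assumes J: "ideal J ring_of_type_algebra" and "\<And>x. x \<in> uq_rels q \<Longrightarrow> free_antihom \<eta> g x \<in> J"
    and "x \<in> uq_ideal q"
  shows "free_antihom \<eta> g x \<in> J"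
proof -
  have "ideal {x. free_antihom \<eta> g x \<in> J} ring_of_type_algebra"
    by (rule ideal_traI) (auto simp: anti_simps ideal_traD[OF J])
  from uq_ideal_minimal[OF this] assms show ?thesis by blast
qed

lemma uq_rep_diff: "coset_rep (uq_class q x) - x \<in> uq_ideal q"
  unfolding uq_class_def by (rule coset_rep_diff[OF ideal_uq])

lemma zero_ideal: "ideal {0 :: 'a::ring_1} ring_of_type_algebra"
  by (rule ideal_traI) auto

lemma uq_counit_class: "uq_counit q (uq_class q x) = free_hom id counit_gen x"
proof -
  have "free_hom id counit_gen r = 0" if "r \<in> uq_rels q" for r
    using that by (auto simp: uq_rels_def id_sc.hom_simps)
  from id_sc.hom_vanish[OF zero_ideal, of q counit_gen, OF _ uq_rep_diff, of x] this
  show ?thesis by (simp add: uq_counit_def id_sc.hom_diff)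
qed

lemma const_left_commute: "const c * (p * r) = p * (const c * (r :: 'w::monoid_add \<Rightarrow>\<^sub>0 'k::field))"
  by (metis const_commute mult.assoc)

lemma antipode_aux:
  fixes E F K L a b c :: "'a::ring_1"
  assumes "a * b = 1" "b * a = 1" "\<And>x. a * x = x * a" "\<And>x. b * x = x * b" "\<And>x. c * x = x * c"
  shows "K * F * E * L - E * L * (K * F) - c * (L - K) =
    - (K * F * (L * K - 1) * (E * L)) + (K * F * L - b * F) * (K * E * L) + b * F * (K * E * L - a * E)
    - (E * F - F * E - c * (K - L)) - E * (L * K - 1) * F"
proof -
  have "b * F * (a * E) = F * E" using assms by (metis mult.assoc mult_1_left)
  thus ?thesis by (simp add: algebra_simps)
qed

lemma uq_antipode_class:
  fixes q :: "'k::field" assumes q: "q \<noteq> 0"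
  shows "uq_antipode q (uq_class q x) = uq_class q (free_antihom const antipode_gen x)"
proof -
  let ?S = "free_antihom const antipode_gen :: 'k free \<Rightarrow> 'k free"
  note I = ideal_traD[OF ideal_uq[of q]]
  define E F K L :: "'k free" where "E = gen GE" "F = gen GF" "K = gen GK" "L = gen GKinv"
  note d = this
  define a b c :: "'k free" where abc: "a = const (q^2)" "b = const (inverse q ^ 2)" "c = const (1 / (q - inverse q))"
  have R: "K * L - 1 \<in> uq_ideal q" "L * K - 1 \<in> uq_ideal q" "K * E * L - a * E \<in> uq_ideal q"
     "K * F * L - b * F \<in> uq_ideal q" "E * F - F * E - c * (K - L) \<in> uq_ideal q"
    using uq_rels_ideal[of q] by (auto simp: uq_rels_def d abc)
  have ab: "a * b = 1" "b * a = 1" using q by (simp_all add: abc const_simps(2)[symmetric] const_simps(4) power_inverse)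
  have cm: "a * x = x * a" "b * x = x * b" "c * x = x * c" for x by (simp_all add: abc const_commute)
  have "?S r \<in> uq_ideal q" if r: "r \<in> uq_rels q" for r
  proof -
    have 3: "?S (K * E * L - a * E) = - ((K * E * L - a * E) * L)"
      by (simp add: d const_sc.anti_simps abc algebra_simps const_commute)
    have 4: "?S (K * F * L - b * F) = - (K * (K * F * L - b * F))"
      by (simp add: d const_sc.anti_simps abc algebra_simps) (metis const_commute mult.assoc)
    have 5: "?S (E * F - F * E - c * (K - L)) = K * F * E * L - E * L * (K * F) - c * (L - K)"
      by (simp add: d const_sc.anti_simps abc algebra_simps const_commute)
    have 1: "?S (K * L - 1) = K * L - 1" "?S (L * K - 1) = L * K - 1"
      by (simp_all add: d const_sc.anti_simps)
    have "?S (E * F - F * E - c * (K - L)) \<in> uq_ideal q"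
      unfolding 5 antipode_aux[OF ab cm, of K F E L] by (intro I R)
    thus ?thesis using r 1 3 4 R I by (auto simp: uq_rels_def d abc)
  qed
  from const_sc.anti_vanish[OF ideal_uq[of q] this uq_rep_diff[of q x]]
  show ?thesis by (simp add: uq_antipode_def const_sc.anti_diff uq_class_eq_iff)
qed

lemma uq_tensor_class: "uq_tensor q (uq_class q x) (uq_class q y) = uq2_class q (inl x * inr y)"
proof -
  let ?x = "coset_rep (uq_class q x)" and ?y = "coset_rep (uq_class q y)"
  note I = ideal_traD[OF ideal_uq2[of q]]
  have *: "inl (p - r) = inl p - inl r" "inr (p - r) = inr p - inr r" for p r :: "'a free"
    using inl_add[of "p - r" r] inr_add[of "p - r" r] by simp_all
  have "inl ?x * inr ?y - inl x * inr y = inl (?x - x) * inr ?y + inl x * inr (?y - y)"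
    by (simp add: * algebra_simps)
  also have "\<dots> \<in> uq2_ideal q" by (intro I uq2_gens_ideal uq_rep_diff)
  finally show ?thesis by (simp add: uq_tensor_def uq2_class_eq_iff)
qed

lemma comult_aux:
  fixes E F K L E' F' K' L' a b c :: "'a::ring_1"
  assumes ab: "a * b = 1" "\<And>x. a * x = x * a" "\<And>x. b * x = x * b" "\<And>x. c * x = x * c"
    and cm: "\<And>x y. x \<in> {E,F,K,L} \<Longrightarrow> y \<in> {E',F',K',L'} \<Longrightarrow> y * x = x * y"
    and J: "ideal J ring_of_type_algebra"
    and R: "K * L - 1 \<in> J" "L * K - 1 \<in> J" "K * E * L - a * E \<in> J"
     "K * F * L - b * F \<in> J" "E * F - F * E - c * (K - L) \<in> J"
    and R': "K' * L' - 1 \<in> J" "L' * K' - 1 \<in> J" "K' * E' * L' - a * E' \<in> J"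
     "K' * F' * L' - b * F' \<in> J" "E' * F' - F' * E' - c * (K' - L') \<in> J"
  shows "K * K' * (L * L') - 1 \<in> J" "L * L' * (K * K') - 1 \<in> J"
    "K * K' * (E * K' + E') * (L * L') - a * (E * K' + E') \<in> J"
    "K * K' * (F + L * F') * (L * L') - b * (F + L * F') \<in> J"
    "(E * K' + E') * (F + L * F') - (F + L * F') * (E * K' + E') - c * (K * K' - L * L') \<in> J"
proof -
  note I = ideal_traD[OF J]
  have c1: "E' * E = E * E'" "F' * E = E * F'" "K' * E = E * K'" "L' * E = E * L'" "E' * F = F * E'" "F' * F = F * F'" "K' * F = F * K'" "L' * F = F * L'" "E' * K = K * E'" "F' * K = K * F'" "K' * K = K * K'" "L' * K = K * L'" "E' * L = L * E'" "F' * L = L * F'" "K' * L = L * K'" "L' * L = L * L'"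
    by (rule cm; simp)+
  have c2: "E' * (E * z) = E * (E' * z)" "F' * (E * z) = E * (F' * z)" "K' * (E * z) = E * (K' * z)" "L' * (E * z) = E * (L' * z)" "E' * (F * z) = F * (E' * z)" "F' * (F * z) = F * (F' * z)" "K' * (F * z) = F * (K' * z)" "L' * (F * z) = F * (L' * z)" "E' * (K * z) = K * (E' * z)" "F' * (K * z) = K * (F' * z)" "K' * (K * z) = K * (K' * z)" "L' * (K * z) = K * (L' * z)" "E' * (L * z) = L * (E' * z)" "F' * (L * z) = L * (F' * z)" "K' * (L * z) = L * (K' * z)" "L' * (L * z) = L * (L' * z)" for z
    by (simp_all add: c1 flip: mult.assoc)
  have c3: "x * (a * z) = a * (x * z)" "x * (b * z) = b * (x * z)" "x * (c * z) = c * (x * z)" for x z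
    using ab by (metis mult.assoc)+
  note c = c1 c2
  have "K * K' * (L * L') - 1 = (K * L - 1) * (K' * L') + (K' * L' - 1)"
    by (simp add: algebra_simps c)
  also have "\<dots> \<in> J" by (intro I R R')
  finally show "K * K' * (L * L') - 1 \<in> J" .
  have "L * L' * (K * K') - 1 = (L * K - 1) * (L' * K') + (L' * K' - 1)"
    by (simp add: algebra_simps c)
  also have "\<dots> \<in> J" by (intro I R R')
  finally show "L * L' * (K * K') - 1 \<in> J" .
  have "K * K' * (E * K' + E') * (L * L') - a * (E * K' + E') =
     (K * E * L - a * E) * (K' * (K' * L')) + a * E * K' * (K' * L' - 1) + (K * L - 1) * (K' * E' * L')
     + (K' * E' * L' - a * E')"
    by (simp add: algebra_simps c)
  also have "\<dots> \<in> J" by (intro I R R')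
  finally show "K * K' * (E * K' + E') * (L * L') - a * (E * K' + E') \<in> J" .
  have "K * K' * (F + L * F') * (L * L') - b * (F + L * F') =
     (K * F * L - b * F) * (K' * L') + b * F * (K' * L' - 1) + (K * L - 1) * L * (K' * F' * L')
     + L * (K' * F' * L' - b * F')"
    by (simp add: algebra_simps c c3)
  also have "\<dots> \<in> J" by (intro I R R')
  finally show "K * K' * (F + L * F') * (L * L') - b * (F + L * F') \<in> J" .
  have EL: "E * L - a * L * E = L * (K * E * L - a * E) - (L * K - 1) * (E * L)"
    by (simp add: algebra_simps c3)
  have KF: "K' * F' - b * F' * K' = (K' * F' * L' - b * F') * K' - K' * F' * (L' * K' - 1)"
    by (simp add: algebra_simps)
  have ELJ: "E * L - a * L * E \<in> J" unfolding EL by (intro I R R')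
  have KFJ: "K' * F' - b * F' * K' \<in> J" unfolding KF by (intro I R R')
  have abx: "a * L * E * (b * F' * K') = L * E * F' * K'"
    using ab by (metis mult.assoc mult_1_left)
  have "(E * K' + E') * (F + L * F') - (F + L * F') * (E * K' + E') - c * (K * K' - L * L')
    = (E * F - F * E - c * (K - L)) * K' + L * (E' * F' - F' * E' - c * (K' - L')) 
      + ((E * L) * (K' * F') - L * E * F' * K')"
    by (simp add: algebra_simps c c3)
  also have "(E * L) * (K' * F') - L * E * F' * K' 
     = (E * L - a * L * E) * (K' * F') + a * L * E * (K' * F' - b * F' * K')"
    unfolding abx[symmetric] by (simp add: algebra_simps)
  also have "(E * F - F * E - c * (K - L)) * K' + L * (E' * F' - F' * E' - c * (K' - L'))
     + ((E * L - a * L * E) * (K' * F') + a * L * E * (K' * F' - b * F' * K')) \<in> J"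
    by (intro I R R' ELJ KFJ)
  finally show "(E * K' + E') * (F + L * F') - (F + L * F') * (E * K' + E') - c * (K * K' - L * L') \<in> J" .
qed

lemma inl_simps: "inl (p + r) = inl p + inl r" "inl (p * r) = inl p * inl r" "inl 1 = 1" "inl (p - r) = inl p - inl r"
  "inl (- p) = - inl p"
proof -
  show 1: "inl 1 = 1" using inl_const[of 1] by (simp add: const_simps del: inl_const)
  show "inl (p - r) = inl p - inl r" using inl_add[of "p - r" r] by simp
  show "inl (- p) = - inl p" using inl_add[of "- p" p] by (simp add: eq_neg_iff_add_eq_0)
qed (rule inl_add inl_mult)+

lemma inr_simps: "inr (p + r) = inr p + inr r" "inr (p * r) = inr p * inr r" "inr 1 = 1" "inr (p - r) = inr p - inr r"
  "inr (- p) = - inr p"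
proof -
  show 1: "inr 1 = 1" using inr_const[of 1] by (simp add: const_simps del: inr_const)
  show "inr (p - r) = inr p - inr r" using inr_add[of "p - r" r] by simp
  show "inr (- p) = - inr p" using inr_add[of "- p" p] by (simp add: eq_neg_iff_add_eq_0)
qed (rule inr_add inr_mult)+

lemma comult_rels:
  fixes q :: "'k::field" assumes q: "q \<noteq> 0" and r: "r \<in> uq_rels q"
  shows "free_hom const comult_gen r \<in> uq2_ideal q"
proof -
  define E F K L :: "'k free2" where "E = inl (gen GE)" "F = inl (gen GF)" "K = inl (gen GK)" "L = inl (gen GKinv)"
  note d = this
  define E' F' K' L' :: "'k free2" where "E' = inr (gen GE)" "F' = inr (gen GF)" "K' = inr (gen GK)" "L' = inr (gen GKinv)"
  note d' = this
  define a b c :: "'k free2" where abc: "a = const (q^2)" "b = const (inverse q ^ 2)" "c = const (1 / (q - inverse q))"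
  have ab: "a * b = 1" using q by (simp_all add: abc const_simps(2)[symmetric] const_simps(4) power_inverse)
  have cm: "a * x = x * a" "b * x = x * b" "c * x = x * c" for x by (simp_all add: abc const_commute)
  have X: "inl ` uq_rels q \<subseteq> uq2_ideal q" "inr ` uq_rels q \<subseteq> uq2_ideal q"
    using uq2_gens_ideal uq_rels_ideal by blast+
  have "K * L - 1 \<in> uq2_ideal q" "L * K - 1 \<in> uq2_ideal q" "K * E * L - a * E \<in> uq2_ideal q"
     "K * F * L - b * F \<in> uq2_ideal q" "E * F - F * E - c * (K - L) \<in> uq2_ideal q"
    using X(1) by (simp_all add: uq_rels_def d abc inl_simps)
  moreover have "K' * L' - 1 \<in> uq2_ideal q" "L' * K' - 1 \<in> uq2_ideal q" "K' * E' * L' - a * E' \<in> uq2_ideal q"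
     "K' * F' * L' - b * F' \<in> uq2_ideal q" "E' * F' - F' * E' - c * (K' - L') \<in> uq2_ideal q"
    using X(2) by (simp_all add: uq_rels_def d' abc inr_simps)
  moreover have "y * x = x * y" if "x \<in> {E,F,K,L}" "y \<in> {E',F',K',L'}" for x y
    using that by (auto simp: d d' inl_inr_commute)
  ultimately have *: "K * K' * (L * L') - 1 \<in> uq2_ideal q" "L * L' * (K * K') - 1 \<in> uq2_ideal q"
    "K * K' * (E * K' + E') * (L * L') - a * (E * K' + E') \<in> uq2_ideal q"
    "K * K' * (F + L * F') * (L * L') - b * (F + L * F') \<in> uq2_ideal q"
    "(E * K' + E') * (F + L * F') - (F + L * F') * (E * K' + E') - c * (K * K' - L * L') \<in> uq2_ideal q"
    using comult_aux[OF ab cm _ ideal_uq2[of q], of E F K L E' F' K' L'] by simp_all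
  from r * show ?thesis unfolding uq_rels_def
    by (auto simp: const_sc.hom_simps d d' abc)
qed

lemma uq_comult_class:
  assumes q: "q \<noteq> 0"
  shows "uq_comult q (uq_class q x) = uq2_class q (free_hom const comult_gen x)"
proof -
  from const_sc.hom_vanish[OF ideal_uq2[of q] comult_rels[OF q] uq_rep_diff[of q x]]
  show ?thesis by (simp add: uq_comult_def const_sc.hom_diff uq2_class_eq_iff)
qed


section \<open>Existence of the automorphism $E \mapsto -E$, $F \mapsto -F$, $K \mapsto K$\<close>

fun tau_gen :: "uq_gen \<Rightarrow> 'k::field free" where
  "tau_gen GE = - gen GE"
| "tau_gen GF = - gen GF"
| "tau_gen GK = gen GK"
| "tau_gen GKinv = gen GKinv"

definition uq_tau :: "'k::field \<Rightarrow> 'k free set \<Rightarrow> 'k free set"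
  where "uq_tau q u = uq_class q (free_hom const tau_gen (coset_rep u))"

abbreviation ftau :: "'k::field free \<Rightarrow> 'k free" where "ftau \<equiv> free_hom const tau_gen"

lemma ftau_ideal:
  assumes "x \<in> uq_ideal q" shows "ftau x \<in> uq_ideal q"
proof (rule const_sc.hom_vanish[OF ideal_uq _ assms])
  fix r assume "r \<in> uq_rels q"
  moreover have "ftau r = r \<or> ftau r = - r" if "r \<in> uq_rels q" for r
    using that by (auto simp: uq_rels_def const_sc.hom_simps)
  ultimately show "ftau r \<in> uq_ideal q"
    using uq_rels_ideal[of q] ideal_traD(6)[OF ideal_uq[of q]] by (metis subsetD)
qed

lemma uq_tau_class: "uq_tau q (uq_class q x) = uq_class q (ftau x)"
  using ftau_ideal[OF uq_rep_diff, of q x] by (simp add: uq_tau_def const_sc.hom_diff uq_class_eq_iff)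

lemma ftau_ftau: "ftau (ftau x) = x"
proof -
  have "ftau (ftau x) = free_hom const gen x"
  proof (rule const_sc.hom_unique)
    fix g :: uq_gen show "ftau (ftau (gen g)) = (gen g :: 'a free)"
      by (cases g) (simp_all add: const_sc.hom_simps)
  qed (auto simp: const_sc.hom_simps)
  also have "free_hom const gen x = x"
    by (rule const_sc.hom_unique[symmetric]) auto
  finally show ?thesis .
qed

definition ftau2 :: "'k::field free2 \<Rightarrow> 'k free2" where
  "ftau2 p = (\<Sum>k\<in>Poly_Mapping.keys p. const (Poly_Mapping.lookup p k) *
     (inl (ftau (Poly_Mapping.single (fst k) 1)) * inr (ftau (Poly_Mapping.single (snd k) 1))))"

lemma ftau2_add: "ftau2 (p + r) = ftau2 p + ftau2 r"
  unfolding ftau2_def by (rule keys_sum_add) (auto simp: const_simps algebra_simps)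

lemma ftau2_single: "ftau2 (Poly_Mapping.single k c) = const c *
     (inl (ftau (Poly_Mapping.single (fst k) 1)) * inr (ftau (Poly_Mapping.single (snd k) 1)))"
  unfolding ftau2_def by (auto simp: const_simps)

lemma ftau2_mult: "ftau2 (p * r) = ftau2 p * ftau2 r"
proof (rule uq_mult_induct[OF ftau2_add])
  fix v w and a b :: 'a
  define x y x' y' where "x = ftau (Poly_Mapping.single (fst v) (1::'a))"
    "y = ftau (Poly_Mapping.single (snd v) (1::'a))" "x' = ftau (Poly_Mapping.single (fst w) (1::'a))"
    "y' = ftau (Poly_Mapping.single (snd w) (1::'a))"
  note d = this
  have 1: "ftau (Poly_Mapping.single (s + t) (1::'a)) = ftau (Poly_Mapping.single s 1) * ftau (Poly_Mapping.single t 1)" for s t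
    using const_sc.hom_mult[of tau_gen "Poly_Mapping.single s (1::'a)" "Poly_Mapping.single t 1"] by (simp add: mult_single)
  have "ftau2 (Poly_Mapping.single v a * Poly_Mapping.single w b) =
    const a * const b * (inl x * inl x' * (inr y * inr y'))"
    by (simp add: mult_single ftau2_single 1 d inl_mult inr_mult const_simps)
  also have "\<dots> = const a * (inl x * inr y) * (const b * (inl x' * inr y'))"
  proof -
    have 1: "inr y * (inl x' * z) = inl x' * (inr y * z)" for z
      by (simp only: mult.assoc[symmetric] inl_inr_commute)
    have 2: "p * (const b * z) = const b * (p * z)" for p z :: "'a free2"
      by (rule const_left_commute[symmetric])
    show ?thesis by (simp add: mult.assoc 1 2)
  qed
  finally show "ftau2 (Poly_Mapping.single v a * Poly_Mapping.single w b) =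
     ftau2 (Poly_Mapping.single v a) * ftau2 (Poly_Mapping.single w b)"
    by (simp add: ftau2_single d)
qed

lemma ftau_single: "ftau (Poly_Mapping.single w c) = const c * ftau (Poly_Mapping.single w 1)"
  by (simp add: const_sc.hom_single const_simps)

lemma ftau2_inl: "ftau2 (inl x) = inl (ftau x)"
proof (induction x rule: pm_induct)
  case (single w c)
  show ?case by (simp add: ftau_single[of w c] inl_mult ftau2_single const_sc.hom_one inr_simps)
qed (auto simp: inl_add ftau2_add const_sc.hom_simps, simp add: ftau2_def)

lemma ftau2_inr: "ftau2 (inr x) = inr (ftau x)"
proof (induction x rule: pm_induct)
  case (single w c)
  show ?case by (simp add: ftau_single[of w c] inr_mult ftau2_single const_sc.hom_one inl_simps)
qed (auto simp: inr_add ftau2_add const_sc.hom_simps, simp add: ftau2_def)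

lemma ftau2_const: "ftau2 (const c) = const c"
  using ftau2_inl[of "const c"] by (simp add: const_sc.hom_simps)

lemma ftau2_uminus: "ftau2 (- p) = - ftau2 p" "ftau2 (p - r) = ftau2 p - ftau2 r"
proof -
  have "ftau2 0 = 0" by (simp add: ftau2_def)
  thus *: "ftau2 (- p) = - ftau2 p" for p using ftau2_add[of "- p" p] by (metis add.left_inverse eq_neg_iff_add_eq_0)
  show "ftau2 (p - r) = ftau2 p - ftau2 r" using ftau2_add[of "p" "-r"] * by simp
qed

lemma ftau2_comult: "ftau2 (free_hom const comult_gen x) = free_hom const comult_gen (ftau x)"
proof -
  have "ftau2 (free_hom const comult_gen x) = free_hom const (\<lambda>g. ftau2 (comult_gen g)) x"
    by (rule const_sc.hom_unique) (auto simp: const_sc.hom_simps ftau2_add ftau2_mult ftau2_const)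
  moreover have "free_hom const comult_gen (ftau x) = free_hom const (\<lambda>g. ftau2 (comult_gen g)) x"
  proof (rule const_sc.hom_unique)
    fix g show "free_hom const comult_gen (ftau (gen g)) = ftau2 (comult_gen g)"
      by (cases g) (simp_all add: const_sc.hom_simps ftau2_add ftau2_mult ftau2_inl ftau2_inr inl_simps inr_simps)
  qed (auto simp: const_sc.hom_simps)
  ultimately show ?thesis by simp
qed

lemma ftau2_ideal:
  assumes "x \<in> uq2_ideal q" shows "ftau2 x \<in> uq2_ideal q"
proof -
  note I = ideal_traD[OF ideal_uq2[of q]]
  have "ideal {x. ftau2 x \<in> uq2_ideal q} ring_of_type_algebra"
    by (rule ideal_traI) (use I in \<open>auto simp: ftau2_add ftau2_mult, simp add: ftau2_def\<close>)
  from uq2_ideal_minimal[OF this _ _ assms] show ?thesis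
    using ftau_ideal uq2_gens_ideal by (fastforce simp: ftau2_inl ftau2_inr)
qed

lemma finsum_uq2_class:
  "(\<Oplus>\<^bsub>Uq2 q\<^esub>i\<in>{..<n::nat}. uq2_class q (f i)) = uq2_class q (\<Sum>i<n. f i)"
proof -
  interpret ring "Uq2 q" by (rule ring_Uq2)
  interpret h: ring_hom_ring ring_of_type_algebra "Uq2 q" "uq2_class q"
    by (rule ring_hom_ringI2[OF ring_tra ring_Uq2 uq2_class_hom])
  show ?thesis
  proof (induction n)
    case 0 show ?case using h.hom_zero by simp
  next
    case (Suc n)
    have "uq2_class q (f i) \<in> carrier (Uq2 q)" for i by (auto simp: carrier_Uq2)
    thus ?case using h.hom_add[of "f n" "\<Sum>i<n. f i"]
      by (simp add: lessThan_Suc Suc.IH Pi_def add.commute)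
  qed
qed

lemma hopf_automorphism_uq_tau:
  fixes q :: "'k::field"
  assumes q: "q \<noteq> 0"
  shows "hopf_automorphism q (uq_tau q)"
  unfolding hopf_automorphism_def
proof (intro conjI allI ballI impI)
  have "uq_tau q \<in> ring_hom (Uq q) (Uq q)"
  proof (rule ring_hom_memI)
    show "uq_tau q \<one>\<^bsub>Uq q\<^esub> = \<one>\<^bsub>Uq q\<^esub>"
      by (simp add: uq_class_simps(3)[symmetric] uq_tau_class const_sc.hom_simps)
  qed (auto simp: carrier_Uq uq_tau_class const_sc.hom_simps uq_class_simps(1,2)[symmetric])
  moreover have "bij_betw (uq_tau q) (carrier (Uq q)) (carrier (Uq q))"
    by (rule bij_betwI[where g = "uq_tau q"]) (auto simp: carrier_Uq uq_tau_class ftau_ftau)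
  ultimately show "uq_tau q \<in> ring_iso (Uq q) (Uq q)"
    by (simp add: ring_iso_def)
next
  fix c u assume "u \<in> carrier (Uq q)"
  thus "uq_tau q (uq_scale q c u) = uq_scale q c (uq_tau q u)"
    by (auto simp: carrier_Uq uq_tau_class const_sc.hom_simps uq_scale_def uq_class_simps(1,2)[symmetric])
next
  fix u assume "u \<in> carrier (Uq q)"
  moreover have "free_hom id counit_gen (ftau x) = free_hom id counit_gen x" for x :: "'k free"
  proof (rule id_sc.hom_unique)
    fix g :: uq_gen show "free_hom id counit_gen (ftau (gen g)) = (counit_gen g :: 'k)"
      by (cases g) (simp_all add: const_sc.hom_simps id_sc.hom_simps)
  qed (simp_all only: const_sc.hom_simps id_sc.hom_simps)
  ultimately show "uq_counit q (uq_tau q u) = uq_counit q u"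
    by (auto simp: carrier_Uq uq_tau_class uq_counit_class)
next
  fix u assume "u \<in> carrier (Uq q)"
  moreover have "free_antihom const antipode_gen (ftau x) = ftau (free_antihom const antipode_gen x)" for x :: "'k free"
  proof -
    have "free_antihom const antipode_gen (ftau x) = free_antihom const (\<lambda>g. ftau (antipode_gen g)) x"
    proof (rule const_sc.anti_unique)
      fix g :: uq_gen show "free_antihom const antipode_gen (ftau (gen g)) = ftau (antipode_gen g)"
        by (cases g) (simp_all add: const_sc.hom_simps const_sc.anti_simps)
    qed (auto simp: const_sc.hom_simps const_sc.anti_simps)
    moreover have "ftau (free_antihom const antipode_gen x) = free_antihom const (\<lambda>g. ftau (antipode_gen g)) x"
      by (rule const_sc.anti_unique) (auto simp: const_sc.hom_simps const_sc.anti_simps)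
    ultimately show ?thesis by simp
  qed
  ultimately show "uq_antipode q (uq_tau q u) = uq_tau q (uq_antipode q u)"
    by (auto simp: carrier_Uq uq_tau_class uq_antipode_class[OF q])
next
  fix u and n :: nat and a b
  assume u: "u \<in> carrier (Uq q)" and a: "a \<in> {..<n} \<rightarrow> carrier (Uq q)" and b: "b \<in> {..<n} \<rightarrow> carrier (Uq q)"
    and eq: "uq_comult q u = (\<Oplus>\<^bsub>Uq2 q\<^esub>i\<in>{..<n}. uq_tensor q (a i) (b i))"
  obtain x where x: "u = uq_class q x" using u by (auto simp: carrier_Uq)
  have "\<forall>i\<in>{..<n}. \<exists>y. a i = uq_class q y" "\<forall>i\<in>{..<n}. \<exists>y. b i = uq_class q y"
    using a b by (force simp: carrier_Uq Pi_def)+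
  then obtain \<alpha> \<beta> where ab: "\<And>i. i < n \<Longrightarrow> a i = uq_class q (\<alpha> i)" "\<And>i. i < n \<Longrightarrow> b i = uq_class q (\<beta> i)"
    by (metis lessThan_iff)
  interpret ring "Uq2 q" by (rule ring_Uq2)
  have 1: "(\<Oplus>\<^bsub>Uq2 q\<^esub>i\<in>{..<n}. uq_tensor q (a i) (b i)) = uq2_class q (\<Sum>i<n. inl (\<alpha> i) * inr (\<beta> i))"
    unfolding finsum_uq2_class[symmetric] by (rule finsum_cong') (auto simp: ab uq_tensor_class carrier_Uq2)
  have 2: "(\<Oplus>\<^bsub>Uq2 q\<^esub>i\<in>{..<n}. uq_tensor q (uq_tau q (a i)) (uq_tau q (b i))) = uq2_class q (\<Sum>i<n. inl (ftau (\<alpha> i)) * inr (ftau (\<beta> i)))"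
    unfolding finsum_uq2_class[symmetric] by (rule finsum_cong') (auto simp: ab uq_tensor_class uq_tau_class carrier_Uq2)
  have s: "ftau2 (\<Sum>i<m. f i) = (\<Sum>i<m. ftau2 (f i))" for m :: nat and f :: "nat \<Rightarrow> 'k free2"
    by (induction m) (auto simp: ftau2_add, simp add: ftau2_def)
  have "free_hom const comult_gen x - (\<Sum>i<n. inl (\<alpha> i) * inr (\<beta> i)) \<in> uq2_ideal q"
    using eq unfolding 1 x by (simp add: uq_comult_class[OF q] uq2_class_eq_iff)
  from ftau2_ideal[OF this]
  have "free_hom const comult_gen (ftau x) - (\<Sum>i<n. inl (ftau (\<alpha> i)) * inr (ftau (\<beta> i))) \<in> uq2_ideal q"
    by (simp add: ftau2_uminus ftau2_comult s ftau2_mult ftau2_inl ftau2_inr)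
  thus "uq_comult q (uq_tau q u) = (\<Oplus>\<^bsub>Uq2 q\<^esub>i\<in>{..<n}. uq_tensor q (uq_tau q (a i)) (uq_tau q (b i)))"
    unfolding 2 x by (simp add: uq_comult_class[OF q] uq2_class_eq_iff uq_tau_class)
qed

lemma uq_tau_uq_tau: "u \<in> carrier (Uq q) \<Longrightarrow> uq_tau q (uq_tau q u) = u"
  by (auto simp: carrier_Uq uq_tau_class ftau_ftau)

lemma uq_tau_gens:
  "uq_tau q (uqE q) = \<ominus>\<^bsub>Uq q\<^esub> uqE q"
  "uq_tau q (uqF q) = \<ominus>\<^bsub>Uq q\<^esub> uqF q"
  "uq_tau q (uqK q) = uqK q"
  by (simp_all add: uq_tau_class const_sc.hom_simps uq_class_uminus)


section \<open>$V_\ell$ is a left module\<close>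

lemma finite_weights: "finite (weights l)"
proof (rule finite_subset)
  show "weights l \<subseteq> (\<lambda>m. of_int m - l) ` {0..\<lfloor>2 * l\<rfloor>}"
  proof
    fix i assume i: "i \<in> weights l"
    then obtain m where m: "i + l = of_int m" by (auto simp: weights_def elim: Ints_cases)
    have "of_int m \<le> 2 * l" "(of_int m :: rat) \<ge> 0" using i unfolding m[symmetric] by (auto simp: weights_def)
    hence "m \<in> {0..\<lfloor>2 * l\<rfloor>}" by (simp add: le_floor_iff)
    moreover have "i = of_int m - l" using m by simp
    ultimately show "i \<in> (\<lambda>m. of_int m - l) ` {0..\<lfloor>2 * l\<rfloor>}" by blast
  qed
qed simp

lemma sum_apply: "(\<Sum>i\<in>A. f i) x = (\<Sum>i\<in>A. f i x)"
  by (induction A rule: infinite_finite_induct) auto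

lemma gen_act_apply:
  "gen_act q l GK f j = (if j \<in> weights l then q powi \<lfloor>2 * j\<rfloor> * f j else 0)"
  "gen_act q l GKinv f j = (if j \<in> weights l then q powi (- \<lfloor>2 * j\<rfloor>) * f j else 0)"
  "gen_act q l GE f j = (if j \<in> weights l \<and> j - 1 \<in> weights l then qint q \<lfloor>l + j\<rfloor> * f (j - 1) else 0)"
  "gen_act q l GF f j = (if j \<in> weights l \<and> j + 1 \<in> weights l then qint q \<lfloor>l - j\<rfloor> * f (j + 1) else 0)"
proof -
  have *: "(\<Sum>i\<in>weights l. g i * (if j = h i \<and> h i \<in> weights l then 1 else 0)) = (if j \<in> weights l \<and> k \<in> weights l then g k else (0::'a))"
    if *: "\<And>i. j = h i \<longleftrightarrow> i = k" for g h k
  proof -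
    have "(\<Sum>i\<in>weights l. g i * (if j = h i \<and> h i \<in> weights l then 1 else 0)) 
      = (\<Sum>i\<in>weights l. if i = k then (if j \<in> weights l then g i else 0) else 0)"
    proof (rule sum.cong)
      fix i assume "i \<in> weights l"
      have "j = h i" if "i = k" using that * by blast
      thus "g i * (if j = h i \<and> h i \<in> weights l then 1 else 0)
        = (if i = k then (if j \<in> weights l then g i else 0) else 0)" using *[of i] by (cases "i = k") auto
    qed simp
    thus ?thesis by (auto simp: finite_weights)
  qed
  note simps = gen_act_def sum_apply fun_scale_def basis_vec_def
  have "gen_act q l GK f j = (\<Sum>i\<in>weights l. (f i * q powi \<lfloor>2 * i\<rfloor>) * (if j = i \<and> i \<in> weights l then 1 else 0))"
    by (simp add: simps mult.assoc)
  also have "\<dots> = (if j \<in> weights l \<and> j \<in> weights l then f (j) * q powi \<lfloor>2 * (j)\<rfloor> else 0)"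
    by (rule *) auto
  finally show "gen_act q l GK f j = (if j \<in> weights l then q powi \<lfloor>2 * j\<rfloor> * f j else 0)"
    by (simp add: mult.commute)
  have "gen_act q l GKinv f j = (\<Sum>i\<in>weights l. (f i * q powi (- \<lfloor>2 * i\<rfloor>)) * (if j = i \<and> i \<in> weights l then 1 else 0))"
    by (simp add: simps mult.assoc)
  also have "\<dots> = (if j \<in> weights l \<and> j \<in> weights l then f (j) * q powi (- \<lfloor>2 * (j)\<rfloor>) else 0)"
    by (rule *) auto
  finally show "gen_act q l GKinv f j = (if j \<in> weights l then q powi (- \<lfloor>2 * j\<rfloor>) * f j else 0)"
    by (simp add: mult.commute)
  have "gen_act q l GE f j = (\<Sum>i\<in>weights l. (f i * qint q \<lfloor>l + i + 1\<rfloor>) * (if j = i + 1 \<and> i + 1 \<in> weights l then 1 else 0))"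
    by (simp add: simps mult.assoc)
  also have "\<dots> = (if j \<in> weights l \<and> j - 1 \<in> weights l then f (j - 1) * qint q \<lfloor>l + (j - 1) + 1\<rfloor> else 0)"
    by (rule *) auto
  finally show "gen_act q l GE f j = (if j \<in> weights l \<and> j - 1 \<in> weights l then qint q \<lfloor>l + j\<rfloor> * f (j - 1) else 0)"
    by (simp add: mult.commute)
  have "gen_act q l GF f j = (\<Sum>i\<in>weights l. (f i * qint q \<lfloor>l - i + 1\<rfloor>) * (if j = i - 1 \<and> i - 1 \<in> weights l then 1 else 0))"
    by (simp add: simps mult.assoc)
  also have "\<dots> = (if j \<in> weights l \<and> j + 1 \<in> weights l then f (j + 1) * qint q \<lfloor>l - (j + 1) + 1\<rfloor> else 0)"
    by (rule *) auto
  finally show "gen_act q l GF f j = (if j \<in> weights l \<and> j + 1 \<in> weights l then qint q \<lfloor>l - j\<rfloor> * f (j + 1) else 0)"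
    by (simp add: mult.commute)
qed

lemma gen_act_add: "gen_act q l x (f + g) = gen_act q l x f + gen_act q l x g"
  by (cases x; rule ext) (auto simp: gen_act_apply algebra_simps)

lemma gen_act_scale: "gen_act q l x (fun_scale c f) = fun_scale c (gen_act q l x f)"
  by (cases x; rule ext) (auto simp: gen_act_apply fun_scale_def)

lemma vec_Vmod: "f \<in> vec (Vmod q l) \<longleftrightarrow> (\<forall>i. i \<notin> weights l \<longrightarrow> f i = 0)"
  by (simp add: Vmod_def)

lemma gen_act_vec: "gen_act q l x f \<in> vec (Vmod q l)"
  by (cases x) (auto simp: vec_Vmod gen_act_apply)

lemma words_act:
  "foldr (gen_act q l) xs (f + g) = foldr (gen_act q l) xs f + foldr (gen_act q l) xs g"
  "foldr (gen_act q l) xs (fun_scale c f) = fun_scale c (foldr (gen_act q l) xs f)"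
  "f \<in> vec (Vmod q l) \<Longrightarrow> foldr (gen_act q l) xs f \<in> vec (Vmod q l)"
  by (induction xs) (auto simp: gen_act_add gen_act_scale gen_act_vec)

lemma free_act_single:
  "free_act q l (Poly_Mapping.single w c) f = fun_scale c (foldr (gen_act q l) (letters w) f)"
  by (auto simp: free_act_def fun_scale_def zero_fun_def)

lemma free_act_add: "free_act q l (p + r) f = free_act q l p f + free_act q l r f"
  unfolding free_act_def by (rule keys_sum_add) (auto simp: fun_scale_def algebra_simps)

lemma free_act_zero: "free_act q l 0 f = 0" by (simp add: free_act_def)

lemma free_act_uminus: "free_act q l (- p) f = - free_act q l p f"
  using free_act_add[of q l "- p" p f] by (metis add.left_inverse eq_neg_iff_add_eq_0 free_act_zero)

lemma free_act_diff: "free_act q l (p - r) f = free_act q l p f - free_act q l r f"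
  using free_act_add[of q l p "- r" f] by (simp add: free_act_uminus)

lemma free_act_vec: "f \<in> vec (Vmod q l) \<Longrightarrow> free_act q l p f \<in> vec (Vmod q l)"
  unfolding free_act_def using words_act(3)[of f q l]
  by (auto simp: vec_Vmod sum_apply fun_scale_def intro!: sum.neutral)

lemma free_act_add_right: "free_act q l p (f + g) = free_act q l p f + free_act q l p g"
  unfolding free_act_def
  by (rule ext) (simp add: sum_apply words_act fun_scale_def algebra_simps sum.distrib)

lemma free_act_scale_right: "free_act q l p (fun_scale c f) = fun_scale c (free_act q l p f)"
  unfolding free_act_def
  by (rule ext) (simp add: sum_apply words_act(2), simp add: sum_apply fun_scale_def sum_distrib_left mult_ac)

lemma free_act_zero_right: "free_act q l p 0 = 0"
  using free_act_scale_right[of q l p 0 0] by (simp add: fun_scale_def zero_fun_def)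

lemma free_act_mult: "free_act q l (p * r) f = free_act q l p (free_act q l r f)"
proof -
  have 1: "free_act q l (Poly_Mapping.single v a * r) f = free_act q l (Poly_Mapping.single v a) (free_act q l r f)" for v a
  proof (induction r rule: pm_induct)
    case (single w c)
    show ?case by (simp add: mult_single free_act_single plus_uq_word_def words_act) (simp add: fun_scale_def mult_ac)
  qed (simp_all only: mult_zero_right free_act_zero free_act_zero_right free_act_add distrib_left free_act_add_right)
  show ?thesis
    by (induction p rule: pm_induct) (simp_all only: mult_zero_left free_act_zero free_act_add distrib_right 1)
qed

lemma free_act_const: "free_act q l (const c) f = fun_scale c f"
  by (simp add: const_def free_act_single zero_uq_word_def)

lemma free_act_one: "free_act q l 1 f = f"
  using free_act_const[of q l 1 f] by (simp add: const_simps fun_scale_def)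

lemma free_act_gen: "free_act q l (gen x) f = gen_act q l x f"
  by (simp add: gen_def free_act_single fun_scale_def)

lemmas free_act_simps = free_act_zero free_act_add free_act_uminus free_act_diff free_act_mult free_act_const
  free_act_one free_act_gen

lemma qint_0 [simp]: "qint q 0 = 0" by (simp add: qint_def)

lemma qint_identity:
  fixes q :: "'k::field"
  assumes "q \<noteq> 0" "q - inverse q \<noteq> 0"
  shows "qint q m * qint q (n + 1) - qint q n * qint q (m + 1) = qint q (m - n)"
proof -
  define x y d where "x = q powi m" "y = q powi n" "d = q - inverse q"
  note xyd = this
  have nz: "x \<noteq> 0" "y \<noteq> 0" "d \<noteq> 0" using assms by (auto simp: xyd)
  have 1: "qint q m = (x - 1 / x) / d" "qint q n = (y - 1 / y) / d"
    "qint q (m + 1) = (x * q - 1 / (x * q)) / d" "qint q (n + 1) = (y * q - 1 / (y * q)) / d"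
    "qint q (m - n) = (x / y - y / x) / d"
    using assms by (simp_all add: qint_def xyd power_int_add power_int_diff power_int_minus field_simps)
  have "(x - 1 / x) * (y * q - 1 / (y * q)) - (y - 1 / y) * (x * q - 1 / (x * q)) = (x / y - y / x) * d"
    using assms(1) nz by (simp add: xyd(3)) (simp add: field_simps)
  hence "qint q m * qint q (n + 1) - qint q n * qint q (m + 1) = (x / y - y / x) * d / (d * d)"
    unfolding 1 by (metis diff_divide_distrib times_divide_times_eq)
  thus ?thesis using nz by (simp add: 1)
qed

lemma free_act_rels:
  fixes q :: "'k::field"
  assumes q: "q \<noteq> 0" "q - inverse q \<noteq> 0" and l: "2 * l \<in> \<int>" and f: "f \<in> vec (Vmod q l)"
    and r: "r \<in> uq_rels q"
  shows "free_act q l r f = 0"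
proof -
  have f0: "f i = 0" if "i \<notin> weights l" for i using f that by (auto simp: vec_Vmod)
  have fl: "\<lfloor>2 * (j - 1)\<rfloor> = \<lfloor>2 * j\<rfloor> - 2" "\<lfloor>2 * (j + 1)\<rfloor> = \<lfloor>2 * j\<rfloor> + 2" for j :: rat
    by (simp_all add: algebra_simps)
  have pw: "q powi (2 - m) = q ^ 2 / q powi m" "q powi (- 2 - m) = 1 / (q ^ 2 * q powi m)" for m
    using q by (simp_all add: power_int_minus power_int_diff power_int_add field_simps)
  have "free_act q l (gen GK * gen GKinv - 1) f = 0"
    by (rule ext) (use q f0 in \<open>auto simp: free_act_simps gen_act_apply power_int_minus\<close>)
  moreover have "free_act q l (gen GKinv * gen GK - 1) f = 0"
    by (rule ext) (use q f0 in \<open>auto simp: free_act_simps gen_act_apply power_int_minus\<close>)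
  moreover have "free_act q l (gen GK * gen GE * gen GKinv - const (q ^ 2) * gen GE) f = 0"
    by (rule ext)
      (use q in \<open>auto simp: free_act_simps gen_act_apply pw fun_scale_def field_simps\<close>)
  moreover have "free_act q l (gen GK * gen GF * gen GKinv - const (inverse q ^ 2) * gen GF) f = 0"
    by (rule ext)
      (use q in \<open>auto simp: free_act_simps gen_act_apply pw fun_scale_def field_simps\<close>)
  moreover have "free_act q l (gen GE * gen GF - gen GF * gen GE
       - const (1 / (q - inverse q)) * (gen GK - gen GKinv)) f = 0"
  proof (rule ext)
    fix j
    show "free_act q l (gen GE * gen GF - gen GF * gen GE
       - const (1 / (q - inverse q)) * (gen GK - gen GKinv)) f j = 0 j"
    proof (cases "j \<in> weights l")
      case False thus ?thesis by (simp add: free_act_simps gen_act_apply fun_scale_def)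
    next
      case True
      then obtain m where m: "l + j = of_int m" by (auto simp: weights_def add.commute elim: Ints_cases)
      obtain t where t: "2 * l = of_int t" using l by (auto elim: Ints_cases)
      define n where "n = t - m"
      have n: "l - j = of_int n" using m t by (simp add: n_def)
      have mn: "2 * j = of_int (m - n)" using m n by simp
      have b: "- l \<le> j" "j \<le> l" "j + l \<in> \<int>" using True by (auto simp: weights_def)
      have m0: "m = 0" if "j - 1 \<notin> weights l"
      proof -
        have "j - 1 + l \<in> \<int>" using b(3) by (metis Ints_1 Ints_diff add_diff_eq diff_add_eq add.commute)
        hence "j - 1 < - l" using that b by (auto simp: weights_def)
        hence "(of_int m :: rat) < 1" "(of_int m :: rat) \<ge> 0" using m b by linarith+
        thus ?thesis by simp
      qed
      have n0: "n = 0" if "j + 1 \<notin> weights l"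
      proof -
        have "j + 1 + l \<in> \<int>" using b(3) by (metis Ints_1 Ints_add add.assoc add.commute)
        hence "j + 1 > l" using that b by (auto simp: weights_def)
        hence "(of_int n :: rat) < 1" "(of_int n :: rat) \<ge> 0" using n b by linarith+
        thus ?thesis by simp
      qed
      have fl': "\<lfloor>l + j\<rfloor> = m" "\<lfloor>l - j\<rfloor> = n" "\<lfloor>2 * j\<rfloor> = m - n" "\<lfloor>l - (j - 1)\<rfloor> = n + 1" "\<lfloor>l + (j + 1)\<rfloor> = m + 1"
      proof -
        have 1: "l - (j - 1) = of_int (n + 1)" "l + (j + 1) = of_int (m + 1)" using m n by simp_all
        show "\<lfloor>l + j\<rfloor> = m" "\<lfloor>l - j\<rfloor> = n" "\<lfloor>2 * j\<rfloor> = m - n" "\<lfloor>l - (j - 1)\<rfloor> = n + 1"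
          "\<lfloor>l + (j + 1)\<rfloor> = m + 1"
          unfolding m n mn 1 by (rule floor_of_int)+
      qed
      have EF: "gen_act q l GE (gen_act q l GF f) j = qint q m * qint q (n + 1) * f j"
        using True m0 by (auto simp: gen_act_apply fl')
      have FE: "gen_act q l GF (gen_act q l GE f) j = qint q n * qint q (m + 1) * f j"
        using True n0 by (auto simp: gen_act_apply fl')
      have K: "gen_act q l GK f j = q powi (m - n) * f j" "gen_act q l GKinv f j = q powi (- (m - n)) * f j"
        using True by (simp_all only: gen_act_apply fl' if_True)
      have "(qint q m * qint q (n + 1) - qint q n * qint q (m + 1)) * f j
          = 1 / (q - inverse q) * (q powi (m - n) * f j - q powi (- (m - n)) * f j)"
        by (simp only: qint_identity[OF q]) (simp add: qint_def diff_divide_distrib left_diff_distrib)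
      thus ?thesis
        by (simp only: free_act_simps fun_scale_def minus_apply EF FE K left_diff_distrib zero_fun_apply) simp
    qed
  qed
  ultimately show ?thesis using r by (auto simp: uq_rels_def)
qed

lemma act_Vmod_class:
  fixes q :: "'k::field"
  assumes q: "q \<noteq> 0" "q - inverse q \<noteq> 0" and l: "2 * l \<in> \<int>" and f: "f \<in> vec (Vmod q l)"
  shows "act (Vmod q l) (uq_class q x) f = free_act q l x f"
proof -
  have "ideal {p. \<forall>f\<in>vec (Vmod q l). free_act q l p f = 0} ring_of_type_algebra"
  proof (rule ideal_traI, goal_cases)
    case (3 x y)
    thus ?case by (auto simp: free_act_simps free_act_zero_right)
  qed (auto simp: free_act_simps free_act_vec)
  from uq_ideal_minimal[OF this _ uq_rep_diff[of q x]] free_act_rels[OF q l]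
  have "free_act q l (coset_rep (uq_class q x) - x) f = 0" using f by blast
  thus ?thesis by (simp add: Vmod_def free_act_diff)
qed

lemma left_module_Vmod:
  fixes q :: "'k::field"
  assumes q: "q \<noteq> 0" "q ^ 2 \<noteq> 1" and l: "2 * l \<in> \<int>"
  shows "left_module q (Vmod q l)"
proof -
  have d: "q - inverse q \<noteq> 0"
  proof
    assume "q - inverse q = 0"
    hence "q * q = q * inverse q" by simp
    thus False using q by (simp add: power2_eq_square)
  qed
  note act = act_Vmod_class[OF q(1) d l]
  have sm: "smul (Vmod q l) = fun_scale" by (simp add: Vmod_def)
  interpret vs: vector_space "fun_scale :: 'k \<Rightarrow> (rat \<Rightarrow> 'k) \<Rightarrow> _"
    by unfold_locales (auto simp: fun_scale_def algebra_simps)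
  have sub: "vs.subspace (vec (Vmod q l))"
    by (rule vs.subspaceI) (auto simp: vec_Vmod fun_scale_def)
  have add: "f + g \<in> vec (Vmod q l)" if "f \<in> vec (Vmod q l)" "g \<in> vec (Vmod q l)" for f g
    using that by (auto simp: vec_Vmod)
  have scl: "fun_scale c f \<in> vec (Vmod q l)" if "f \<in> vec (Vmod q l)" for c f
    using that by (auto simp: vec_Vmod fun_scale_def)
  show ?thesis unfolding left_module_def sm
    by (auto simp: vs.vector_space_axioms sub carrier_Uq act free_act_vec add scl free_act_add_right
      free_act_scale_right uq_class_simps[symmetric] uq_scale_def free_act_simps)
qed

lemma act_Vmod_basis:
  fixes q :: "'k::field"
  assumes q: "q \<noteq> 0" "q ^ 2 \<noteq> 1" and l: "2 * l \<in> \<int>" and i: "i \<in> weights l"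
  shows "act (Vmod q l) (uq_class q (gen x)) (basis_vec l i) = gen_on_basis q l x i"
proof -
  have d: "q - inverse q \<noteq> 0"
  proof
    assume "q - inverse q = 0"
    hence "q * q = q * inverse q" by simp
    thus False using q by (simp add: power2_eq_square)
  qed
  have "basis_vec l i \<in> vec (Vmod q l)" by (auto simp: vec_Vmod basis_vec_def)
  hence "act (Vmod q l) (uq_class q (gen x)) (basis_vec l i) = gen_act q l x (basis_vec l i)"
    using act_Vmod_class[OF q(1) d l] by (simp add: free_act_gen)
  also have "\<dots> = (\<Sum>j\<in>weights l. if j = i then gen_on_basis q l x j else 0)"
    unfolding gen_act_def by (rule sum.cong) (auto simp: basis_vec_def fun_scale_def i zero_fun_def)
  also have "\<dots> = gen_on_basis q l x i" using i by (simp add: finite_weights)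
  finally show ?thesis .
qed

end

theory Submission
  imports Defs
begin

text \<open>
  An element of \<open>Hom\<^sub>U(V, V\<^sup>\<sharp>)\<close> is a bilinear form \<open>b\<close> with \<open>b(uv, w) = b(v, S(\<tau> u) w)\<close>, and
  the map whose trace is taken sends \<open>b\<close> to \<open>(v, w) \<mapsto> b(w, Kv)\<close>. Put \<open>n = 2\<ell>\<close> and
  \<open>e a = v\<^sub>i\<close> with \<open>i = a - \<ell>\<close>. Invariance under \<open>K\<close> forces \<open>b(e a, e b) = 0\<close> unless
  \<open>a + b = n\<close>, and invariance under \<open>E\<close> is the recursion
  \<open>[a+1] c(a+1) = q^(2a+2-n) [n-a] c(a)\<close> for \<open>c(a) = b(e a, e (n-a))\<close>. Its solutions are the
  multiples of \<open>d(a) = q^(a(a+1)-na) / ([a]! [n-a]!)\<close>, which also give an \<open>F\<close>-invariant form.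
  So the space of forms is one-dimensional, and \<open>d(a) = q^(2a-n) d(n-a)\<close> says that it is fixed
  pointwise: the trace is \<open>1\<close>.
\<close>

section \<open>Twisted antipode on representatives\<close>

text \<open>Lets statements be checked on scalars and the four generators; monomials are built up
  letter by letter.\<close>

lemma free_induct [case_names const gen add mult]:
  fixes p :: "'k::field free"
  assumes const: "\<And>c. P (const c)" and gen: "\<And>x. P (gen x)"
    and add: "\<And>p r. P p \<Longrightarrow> P r \<Longrightarrow> P (p + r)" and mult: "\<And>p r. P p \<Longrightarrow> P r \<Longrightarrow> P (p * r)"
  shows "P p"
proof (induction p rule: pm_induct)
  case zero
  show ?case using const[of 0] by (simp add: const_simps)
next
  case (add x y)
  thus ?case by (rule assms(3))
next
  case (single w c)
  have "P (Poly_Mapping.single (Word xs) 1)" for xs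
  proof (induction xs)
    case Nil
    show ?case using const[of 1] by (simp add: const_def zero_uq_word_def)
  next
    case (Cons x xs)
    have "Poly_Mapping.single (Word (x # xs)) (1::'k) = gen x * Poly_Mapping.single (Word xs) 1"
      by (simp add: gen_def mult_single plus_uq_word_def)
    thus ?case by (simp add: gen mult Cons.IH)
  qed
  from mult[OF const[of c] this[of "letters w"]] show ?case
    by (simp add: const_def mult_single)
qed

text \<open>Scalars and generators determine an algebra map, so an arbitrary \<open>\<tau>\<close>
  can be replaced by the explicit \<open>ftau\<close> on representatives. Its value on the inverse
  of K is not given and has to be derived.\<close>

lemma hopf_automorphism_class:
  fixes q :: "'k::field"
  assumes hopf: "hopf_automorphism q \<tau>" and E: "\<tau> (uqE q) = \<ominus>\<^bsub>Uq q\<^esub> uqE q"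
    and F: "\<tau> (uqF q) = \<ominus>\<^bsub>Uq q\<^esub> uqF q" and K: "\<tau> (uqK q) = uqK q"
  shows "\<tau> (uq_class q p) = uq_class q (ftau p)"
proof -
  interpret U: ring "Uq q" by (rule ring_Uq)
  have hom: "\<tau> \<in> ring_hom (Uq q) (Uq q)"
    using hopf by (simp add: hopf_automorphism_def ring_iso_def)
  have cl: "uq_class q x \<in> carrier (Uq q)" for x by (auto simp: carrier_Uq)
  note t = ring_hom_add[OF hom cl cl] ring_hom_mult[OF hom cl cl]
  show ?thesis
  proof (induction p rule: free_induct)
    case (const c)
    \<comment> \<open>The class of \<open>const c\<close> is c times the unit, so compatibility with
      scaling applies.\<close>
    have "\<tau> (uq_scale q c \<one>\<^bsub>Uq q\<^esub>) = uq_scale q c (\<tau> \<one>\<^bsub>Uq q\<^esub>)"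
      using hopf by (simp add: hopf_automorphism_def)
    thus ?case by (simp add: ring_hom_one[OF hom] uq_scale_def cl const_sc.hom_simps)
  next
    case (gen x)
    let ?L = "uq_class q (gen GKinv)"
    have KL: "uqK q \<otimes>\<^bsub>Uq q\<^esub> ?L = \<one>\<^bsub>Uq q\<^esub>" and LK: "?L \<otimes>\<^bsub>Uq q\<^esub> uqK q = \<one>\<^bsub>Uq q\<^esub>"
      using uq_rels_ideal[of q]
      by (auto simp: uq_class_simps[symmetric] uq_class_eq_iff uq_rels_def)
    have tL: "\<tau> ?L \<in> carrier (Uq q)" by (rule ring_hom_closed[OF hom cl])
    have "uqK q \<otimes>\<^bsub>Uq q\<^esub> \<tau> ?L = \<one>\<^bsub>Uq q\<^esub>"
      using t(2)[of "gen GK" "gen GKinv"] by (simp add: KL K ring_hom_one[OF hom])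
    \<comment> \<open>A left and a right inverse of K coincide.\<close>
    hence "\<tau> ?L = ?L"
      using U.inv_unique[OF LK, of "\<tau> ?L"] cl tL by simp
    thus ?case by (cases x) (simp_all add: const_sc.hom_simps uq_class_uminus E F K)
  qed (simp_all add: uq_class_simps t const_sc.hom_simps)
qed

abbreviation anti_tau :: "'k::field free \<Rightarrow> 'k free"
  where "anti_tau p \<equiv> free_antihom const antipode_gen (ftau p)"

text \<open>The signs of \<open>ftau\<close> and of the antipode on E and F cancel, so no sign
  enters the recursion for the coefficients of a form.\<close>

lemma anti_tau_simps:
  "anti_tau (const c) = const c"
  "anti_tau (p + r) = anti_tau p + anti_tau r"
  "anti_tau (p * r) = anti_tau r * anti_tau p"
  "anti_tau (gen GE) = gen GE * gen GKinv"
  "anti_tau (gen GF) = gen GK * gen GF"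
  "anti_tau (gen GK) = gen GKinv"
  "anti_tau (gen GKinv) = gen GK"
  by (simp_all add: const_sc.hom_simps const_sc.anti_simps)


section \<open>The trace of the identity of a line\<close>

text \<open>The basis chosen by \<open>space_trace\<close> is unspecified and need not be
  \<open>{x}\<close>. In any basis the trace of the identity counts the basis vectors, and their
  number is the dimension.\<close>

lemma space_trace_line:
  fixes V :: "('k::field, 'v::ab_group_add) vspace"
  assumes vs: "vector_space (smul V)" and x: "x \<noteq> 0" and V: "vec V = range (\<lambda>c. smul V c x)"
    and T: "\<And>v. v \<in> vec V \<Longrightarrow> T v = v"
  shows "space_trace V T = 1"
proof -
  interpret vector_space "smul V" by (rule vs)
  have sx: "span {x} = vec V" by (simp add: span_singleton V)
  have ix: "independent {x}" using x by simp
  define B where "B = (SOME B. B \<subseteq> vec V \<and> independent B \<and> span B = vec V)"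
  have "\<exists>B. B \<subseteq> vec V \<and> independent B \<and> span B = vec V"
    using sx ix span_superset by blast
  from someI_ex[OF this] have B: "B \<subseteq> vec V" "independent B" "span B = vec V"
    by (auto simp: B_def)
  have "card B = 1"
    using dim_eq_card[OF _ B(2), of "{x}"] dim_eq_card[OF _ ix, of "{x}"] B(3) sx by simp
  have "space_trace V T = (\<Sum>b\<in>B. representation B (T b) b)"
    by (simp add: space_trace_def B_def Let_def)
  also have "\<dots> = (\<Sum>b\<in>B. 1)"
    by (rule sum.cong) (use B T in \<open>auto simp: representation_basis\<close>)
  finally show ?thesis using \<open>card B = 1\<close> by simp
qed


lemma fun_scale_apply: "fun_scale c f i = c * f i"
  by (simp add: fun_scale_def)


section \<open>Invariant forms on $V_\ell$\<close>

text \<open>The number n is twice the highest weight; a weight i is recorded by the natural number i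
  + \<open>hw\<close> in \<open>{..n}\<close>, which removes half-integers and floors.\<close>

locale generic_weight_module =
  fixes q :: "'k::field" and n :: nat
  assumes q_nz: "q \<noteq> 0" and q_not_root: "\<And>m::nat. m > 0 \<Longrightarrow> q ^ m \<noteq> 1"
begin

section \<open>Weights, basis vectors and generators in integer coordinates\<close>

definition hw :: rat where "hw = of_nat n / 2"
abbreviation V :: "('k, rat \<Rightarrow> 'k) umodule" where "V \<equiv> Vmod q hw"

definition wt :: "nat \<Rightarrow> rat" where "wt a = of_nat a - hw"

definition e :: "nat \<Rightarrow> rat \<Rightarrow> 'k" where "e a = basis_vec hw (wt a)"

lemma q_sq: "q ^ 2 \<noteq> 1" by (rule q_not_root) simp

lemma q_diff: "q - inverse q \<noteq> 0"
proof
  assume "q - inverse q = 0"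
  hence "q * q = q * inverse q" by simp
  thus False using q_nz q_sq by (simp add: power2_eq_square)
qed

lemma powi_eq_1: "q powi m = 1 \<longleftrightarrow> m = 0"
proof
  assume m: "q powi m = 1"
  have "q ^ nat \<bar>m\<bar> = 1"
    using m by (auto simp: power_int_def abs_if power_inverse split: if_splits)
  thus "m = 0" using q_not_root[of "nat \<bar>m\<bar>"] by (cases "m = 0") auto
qed simp

text \<open>Otherwise q^(2m) = 1, although q is not a root of unity.\<close>

lemma qint_nz: "m \<noteq> 0 \<Longrightarrow> qint q m \<noteq> 0"
proof
  assume m: "m \<noteq> 0" "qint q m = 0"
  hence "q powi m = q powi (- m)" using q_diff by (simp add: qint_def)
  hence "q powi (m - (- m)) = 1" using q_nz by (subst power_int_diff) auto
  thus False using m powi_eq_1 by simp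
qed

lemma hw_hw: "hw + hw = of_nat n" by (simp add: hw_def)

lemma wt_inj [simp]: "wt a = wt b \<longleftrightarrow> a = b" by (simp add: wt_def)

lemma weights_eq: "weights hw = wt ` {..n}"
proof (intro equalityI subsetI)
  fix i assume i: "i \<in> weights hw"
  hence "i + hw \<in> \<int>" unfolding weights_def by blast
  then obtain m where m: "i + hw = of_int m" by (rule Ints_cases)
  have "0 \<le> i + hw" "i + hw \<le> of_nat n"
    using i hw_hw unfolding weights_def by auto
  hence "(of_int 0 :: rat) \<le> of_int m" "(of_int m :: rat) \<le> of_int (int n)"
    unfolding m by simp_all
  hence "0 \<le> m" "m \<le> int n" by (simp_all only: of_int_le_iff)
  moreover from \<open>0 \<le> m\<close> have "i = wt (nat m)" using m by (simp add: wt_def eq_diff_eq)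
  ultimately show "i \<in> wt ` {..n}" by auto
next
  fix i assume "i \<in> wt ` {..n}"
  then obtain a where a: "a \<le> n" "i = of_nat a - hw" by (auto simp: wt_def)
  have "(of_nat a :: rat) \<le> hw + hw" using a(1) by (simp add: hw_hw)
  thus "i \<in> weights hw" by (simp add: weights_def a(2))
qed

lemma wt_weights [simp]: "wt a \<in> weights hw \<longleftrightarrow> a \<le> n" by (auto simp: weights_eq image_iff)

lemma wt_0_notin: "wt 0 - 1 \<notin> weights hw" by (simp add: weights_def wt_def)

lemma wt_Suc: "wt (Suc a) - 1 = wt a" "wt a + 1 = wt (Suc a)" by (simp_all add: wt_def)

lemma vec_eqI:
  assumes "v \<in> vec V" "w \<in> vec V" "\<And>a. a \<le> n \<Longrightarrow> v (wt a) = w (wt a)" shows "v = w"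
proof
  fix i show "v i = w i"
    using assms by (cases "i \<in> weights hw") (auto simp: vec_Vmod weights_eq)
qed

lemma vec_closed:
  "v \<in> vec V \<Longrightarrow> w \<in> vec V \<Longrightarrow> v + w \<in> vec V" "v \<in> vec V \<Longrightarrow> fun_scale c v \<in> vec V"
  by (auto simp: vec_Vmod fun_scale_def)

lemma e_vec: "e a \<in> vec V" by (auto simp: vec_Vmod e_def basis_vec_def)

lemma e_apply: "b \<le> n \<Longrightarrow> e a (wt b) = (if a = b then 1 else 0)"
  by (auto simp: e_def basis_vec_def)

text \<open>Read off by target coordinate: E carries the coordinate at a to a + 1 and F carries it
  back. The zeros at the two ends later shorten sums by one term.\<close>

lemma gen_act_wt:
  "a \<le> n \<Longrightarrow> gen_act q hw GK v (wt a) = q powi (2 * int a - int n) * v (wt a)"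
  "a \<le> n \<Longrightarrow> gen_act q hw GKinv v (wt a) = q powi (int n - 2 * int a) * v (wt a)"
  "gen_act q hw GE v (wt 0) = 0"
  "a < n \<Longrightarrow> gen_act q hw GE v (wt (Suc a)) = qint q (int a + 1) * v (wt a)"
  "gen_act q hw GF v (wt n) = 0"
  "a < n \<Longrightarrow> gen_act q hw GF v (wt a) = qint q (int n - int a) * v (wt (Suc a))"
proof -
  have "2 * wt a = of_int (2 * int a - int n)" for a
    using hw_hw by (simp add: wt_def)
  hence 1: "\<lfloor>2 * wt a\<rfloor> = 2 * int a - int n" for a by (simp only: floor_of_int)
  have "hw + wt (Suc a) = of_int (int a + 1)" by (simp add: wt_def)
  hence 2: "\<lfloor>hw + wt (Suc a)\<rfloor> = int a + 1" by (simp only: floor_of_int)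
  have "hw - wt a = of_int (int n - int a)"
    using hw_hw by (simp add: wt_def)
  hence 3: "\<lfloor>hw - wt a\<rfloor> = int n - int a" by (simp only: floor_of_int)
  show "a \<le> n \<Longrightarrow> gen_act q hw GK v (wt a) = q powi (2 * int a - int n) * v (wt a)"
    "a \<le> n \<Longrightarrow> gen_act q hw GKinv v (wt a) = q powi (int n - 2 * int a) * v (wt a)"
    by (simp_all only: gen_act_apply wt_weights 1 if_True minus_diff_eq)
  show "gen_act q hw GE v (wt 0) = 0" "gen_act q hw GF v (wt n) = 0"
    by (simp_all add: gen_act_apply wt_0_notin wt_Suc)
  show "a < n \<Longrightarrow> gen_act q hw GE v (wt (Suc a)) = qint q (int a + 1) * v (wt a)"
    "a < n \<Longrightarrow> gen_act q hw GF v (wt a) = qint q (int n - int a) * v (wt (Suc a))"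
    by (simp_all add: gen_act_apply wt_Suc 2 3)
qed

lemma gen_act_e:
  "a \<le> n \<Longrightarrow> gen_act q hw GK (e a) = fun_scale (q powi (2 * int a - int n)) (e a)"
  "a \<le> n \<Longrightarrow> gen_act q hw GKinv (e a) = fun_scale (q powi (int n - 2 * int a)) (e a)"
  "a < n \<Longrightarrow> gen_act q hw GE (e a) = fun_scale (qint q (int a + 1)) (e (Suc a))"
proof -
  show "a \<le> n \<Longrightarrow> gen_act q hw GK (e a) = fun_scale (q powi (2 * int a - int n)) (e a)"
    "a \<le> n \<Longrightarrow> gen_act q hw GKinv (e a) = fun_scale (q powi (int n - 2 * int a)) (e a)"
    by (rule vec_eqI; auto simp: gen_act_vec vec_closed e_vec gen_act_wt fun_scale_apply e_apply)+
  assume "a < n"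
  show "gen_act q hw GE (e a) = fun_scale (qint q (int a + 1)) (e (Suc a))"
  proof (rule vec_eqI)
    fix b assume "b \<le> n"
    thus "gen_act q hw GE (e a) (wt b) = fun_scale (qint q (int a + 1)) (e (Suc a)) (wt b)"
      by (cases b) (auto simp: gen_act_wt fun_scale_apply e_apply)
  qed (auto simp: gen_act_vec vec_closed e_vec)
qed

section \<open>Maps from V to its dual as bilinear forms\<close>

definition invariant :: "((rat \<Rightarrow> 'k) \<Rightarrow> (rat \<Rightarrow> 'k) \<Rightarrow> 'k) \<Rightarrow> bool"
  where "invariant f \<longleftrightarrow> (\<forall>p. \<forall>v\<in>vec V. \<forall>w\<in>vec V.
    f (free_act q hw p v) w = f v (free_act q hw (anti_tau p) w))"

text \<open>After currying, a linear map into the dual is a bilinear form extended by zero; hence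
  linearity in \<open>v\<close> holds for every \<open>w\<close>, inside \<open>V\<close> or
  not.\<close>

lemma linear_maps_dual_iff:
  "f \<in> linear_maps V (sharp q \<tau> V) \<longleftrightarrow>
    (\<forall>v\<in>vec V. \<forall>v'\<in>vec V. \<forall>w. f (v + v') w = f v w + f v' w) \<and>
    (\<forall>v\<in>vec V. \<forall>w\<in>vec V. \<forall>w'\<in>vec V. f v (w + w') = f v w + f v w') \<and>
    (\<forall>c. \<forall>v\<in>vec V. \<forall>w. f (fun_scale c v) w = c * f v w) \<and>
    (\<forall>c. \<forall>v\<in>vec V. \<forall>w\<in>vec V. f v (fun_scale c w) = c * f v w) \<and>
    (\<forall>v w. v \<notin> vec V \<or> w \<notin> vec V \<longrightarrow> f v w = 0)"
  by (auto simp: linear_maps_def sharp_def dual_space_def ground_def fun_eq_iff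
      Vmod_def[of q hw, THEN arg_cong[of _ _ smul]])

lemma linear_maps_dualD:
  assumes "f \<in> linear_maps V (sharp q \<tau> V)"
  shows "v \<in> vec V \<Longrightarrow> v' \<in> vec V \<Longrightarrow> f (v + v') w = f v w + f v' w"
    and "v \<in> vec V \<Longrightarrow> w \<in> vec V \<Longrightarrow> w' \<in> vec V \<Longrightarrow> f v (w + w') = f v w + f v w'"
    and "v \<in> vec V \<Longrightarrow> f (fun_scale c v) w = c * f v w"
    and "v \<in> vec V \<Longrightarrow> w \<in> vec V \<Longrightarrow> f v (fun_scale c w) = c * f v w"
    and "v \<notin> vec V \<or> w \<notin> vec V \<Longrightarrow> f v w = 0"
  using assms unfolding linear_maps_dual_iff by blast+

lemma bilinear_expand:
  assumes f: "f \<in> linear_maps V (sharp q \<tau> V)" and v: "v \<in> vec V" and w: "w \<in> vec V"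
  shows "f v w = (\<Sum>a\<le>n. \<Sum>b\<le>n. v (wt a) * w (wt b) * f (e a) (e b))"
proof -
  note f' = linear_maps_dualD[OF f]
  \<comment> \<open>Partial sums allow additivity to be applied by induction on m; the full
    expansion is m = \<open>Suc n\<close>.\<close>
  let ?s = "\<lambda>c m. \<Sum>a<m. fun_scale (c a) (e a)"
  have expand: "v = ?s (\<lambda>a. v (wt a)) (Suc n)" if "v \<in> vec V" for v
  proof (rule vec_eqI[OF that])
    show "?s (\<lambda>a. v (wt a)) (Suc n) \<in> vec V"
      by (auto simp: vec_Vmod sum_apply fun_scale_apply e_def basis_vec_def intro!: sum.neutral)
    fix b assume b: "b \<le> n"
    have "?s (\<lambda>a. v (wt a)) (Suc n) (wt b) = (\<Sum>a<Suc n. if a = b then v (wt a) else 0)"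
      unfolding sum_apply by (rule sum.cong) (auto simp: fun_scale_apply e_apply b)
    thus "v (wt b) = ?s (\<lambda>a. v (wt a)) (Suc n) (wt b)" using b by (simp del: sum.lessThan_Suc)
  qed
  have zero: "0 \<in> vec V" by (simp add: vec_Vmod)
  have f0: "f 0 w = 0" "u \<in> vec V \<Longrightarrow> f u 0 = 0" for w u
    using f'(3)[OF zero, of 0 w] f'(4)[OF _ zero, of u 0]
    by (simp_all add: fun_scale_def zero_fun_def)
  have closed: "?s c m \<in> vec V" for c m
    by (induction m) (simp_all only: sum.lessThan_Suc lessThan_0 sum.empty zero vec_closed e_vec)
  have L: "f (?s c m) w = (\<Sum>a<m. c a * f (e a) w)" for c w m
    by (induction m)
      (simp_all only: sum.lessThan_Suc lessThan_0 sum.empty f0 f' closed vec_closed e_vec)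
  have R: "f u (?s c m) = (\<Sum>a<m. c a * f u (e a))" if "u \<in> vec V" for c u m
    by (induction m)
      (simp_all only: sum.lessThan_Suc lessThan_0 sum.empty f0 f' closed vec_closed e_vec that)
  have "f v w = f (?s (\<lambda>a. v (wt a)) (Suc n)) (?s (\<lambda>a. w (wt a)) (Suc n))"
    using expand[OF v] expand[OF w] by (rule arg_cong2)
  thus ?thesis unfolding L R[OF e_vec] unfolding lessThan_Suc_atMost
    by (simp add: sum_distrib_left mult.assoc)
qed

section \<open>The explicit invariant form\<close>

definition qfact :: "nat \<Rightarrow> 'k" where "qfact a = (\<Prod>j<a. qint q (int j + 1))"

text \<open>For \<open>a \<le> n\<close> and up to the factor \<open>1 / qfact n\<close>, a power of
  q times a symmetric q-binomial coefficient. The exponent grows by 2a + 2 - n from a to a + 1, as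
  E-invariance demands.\<close>

definition d :: "nat \<Rightarrow> 'k"
  where "d a = q powi (int a * (int a + 1) - int n * int a) / (qfact a * qfact (n - a))"

lemma qfact_nz: "qfact a \<noteq> 0" by (auto simp: qfact_def intro!: qint_nz)

lemma d_nz: "d a \<noteq> 0" by (simp add: d_def qfact_nz q_nz)

lemma d_Suc:
  assumes "a < n"
  shows "qint q (int a + 1) * d (Suc a) = q powi (2 * int a + 2 - int n) * qint q (int n - int a) * d a"
proof -
  have na: "n - a = Suc (n - Suc a)" using assms by simp
  have 1: "qfact (Suc a) = qint q (int a + 1) * qfact a" by (simp add: qfact_def)
  have 2: "qfact (n - a) = qint q (int n - int a) * qfact (n - Suc a)"
    unfolding na qfact_def using assms by (simp add: of_nat_diff)
  have 3: "q powi (int (Suc a) * (int (Suc a) + 1) - int n * int (Suc a)) =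
      q powi (2 * int a + 2 - int n) * q powi (int a * (int a + 1) - int n * int a)"
    by (subst power_int_add[symmetric]) (use q_nz in \<open>auto simp: algebra_simps\<close>)
  have "qint q (int a + 1) \<noteq> 0" "qint q (int n - int a) \<noteq> 0"
    using assms by (auto intro!: qint_nz)
  thus ?thesis unfolding d_def 1 2 3 using qfact_nz by (simp add: field_simps)
qed

text \<open>The denominator is symmetric under exchanging a and n - a, and the two exponents differ
  by 2a - n.\<close>

lemma d_symmetric:
  assumes "a \<le> n" shows "d a = q powi (2 * int a - int n) * d (n - a)"
proof -
  have "q powi (int a * (int a + 1) - int n * int a) = q powi (2 * int a - int n) *
      q powi (int (n - a) * (int (n - a) + 1) - int n * int (n - a))"
    by (subst power_int_add[symmetric]) (use q_nz assms in \<open>auto simp: of_nat_diff algebra_simps\<close>)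
  thus ?thesis using assms by (simp add: d_def mult.commute)
qed

definition form :: "(rat \<Rightarrow> 'k) \<Rightarrow> (rat \<Rightarrow> 'k) \<Rightarrow> 'k"
  where "form v w = (if v \<in> vec V \<and> w \<in> vec V
    then \<Sum>a\<le>n. d a * v (wt a) * w (wt (n - a)) else 0)"

lemma form_linear: "form \<in> linear_maps V (sharp q \<tau> V)"
  unfolding linear_maps_dual_iff
  by (auto simp: form_def vec_closed fun_scale_apply algebra_simps sum.distrib sum_distrib_left)

lemma form_nz: "form \<noteq> 0"
proof
  assume "form = 0"
  hence "form (e 0) (e n) = 0" by simp
  moreover have "form (e 0) (e n) = (\<Sum>a\<le>n. d a * e 0 (wt a) * e n (wt (n - a)))"
    by (simp add: form_def e_vec)
  moreover have "\<dots> = (\<Sum>a\<le>n. if a = 0 then d a else 0)"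
    by (rule sum.cong) (auto simp: e_apply)
  ultimately show False using d_nz by simp
qed

text \<open>Swapping the arguments exchanges a and n - a, and the eigenvalue of K makes up for the
  difference between \<open>d a\<close> and \<open>d (n - a)\<close>. Hence the map whose trace is
  taken fixes \<open>form\<close>.\<close>

lemma form_K: "form w (gen_act q hw GK v) = form v w" if "v \<in> vec V" "w \<in> vec V"
proof -
  have "form w (gen_act q hw GK v)
    = (\<Sum>a\<le>n. d a * w (wt a) * (q powi (2 * int (n - a) - int n) * v (wt (n - a))))"
    using that by (simp add: form_def gen_act_vec gen_act_wt)
  also have "\<dots> = (\<Sum>a\<le>n. d (n - a) * w (wt (n - a)) * (q powi (2 * int a - int n) * v (wt a)))"
    by (rule sum.reindex_bij_witness[of _ "\<lambda>a. n - a" "\<lambda>a. n - a"]) auto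
  also have "\<dots> = form v w"
    unfolding form_def using that
    by (simp, intro sum.cong refl) (subst (2) d_symmetric, auto)
  finally show ?thesis .
qed

lemma form_gen:
  assumes v: "v \<in> vec V" and w: "w \<in> vec V"
  shows "form (gen_act q hw x v) w = form v (free_act q hw (anti_tau (gen x)) w)"
proof -
  note simps = anti_tau_simps free_act_simps form_def gen_act_vec v w
  \<comment> \<open>Two ways to drop a vanishing term: \<open>S\<close> loses a = 0 and shifts the
    index, \<open>S'\<close> loses a = n without a shift.\<close>
  have S: "(\<Sum>a\<le>n. h a) = (\<Sum>a<n. g a)" if "h 0 = 0" "\<And>a. a < n \<Longrightarrow> h (Suc a) = g a"
    for h g :: "nat \<Rightarrow> 'k"
    using that by (simp add: sum.lessThan_Suc_shift flip: lessThan_Suc_atMost del: sum.lessThan_Suc)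
  have S': "(\<Sum>a\<le>n. h a) = (\<Sum>a<n. g a)" if "h n = 0" "\<And>a. a < n \<Longrightarrow> h a = g a"
    for h g :: "nat \<Rightarrow> 'k"
    using that by (simp flip: lessThan_Suc_atMost)
  show ?thesis
  proof (cases x)
    \<comment> \<open>Paired basis vectors have opposite weights, which matches the inverse in
      \<open>anti_tau (gen GK)\<close>.\<close>
    case GK
    thus ?thesis by (auto simp: simps gen_act_wt of_nat_diff intro!: sum.cong)
  next
    case GKinv
    thus ?thesis by (auto simp: simps gen_act_wt of_nat_diff intro!: sum.cong)
  next
    case GE
    let ?g = "\<lambda>a. q powi (2 * int a + 2 - int n) * qint q (int n - int a) * d a * v (wt a) * w (wt (n - Suc a))"
    have "form (gen_act q hw GE v) w = (\<Sum>a<n. ?g a)"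
      unfolding form_def using w
      by (simp add: gen_act_vec) (rule S, auto simp: gen_act_wt simp flip: d_Suc)
    also have "\<dots> = form v (gen_act q hw GE (gen_act q hw GKinv w))"
    proof -
      have "gen_act q hw GE (gen_act q hw GKinv w) (wt (n - a)) = qint q (int n - int a) *
         (q powi (2 * int a + 2 - int n) * w (wt (n - Suc a)))" if "a < n" for a
      proof -
        have na: "n - a = Suc (n - Suc a)" using that by simp
        show ?thesis unfolding na using that
          by (simp add: gen_act_wt of_nat_diff) (simp add: algebra_simps)
      qed
      thus ?thesis unfolding form_def using v
        by (simp add: gen_act_vec) (rule S'[symmetric], auto simp: gen_act_wt)
    qed
    finally show ?thesis using GE by (simp add: anti_tau_simps free_act_simps)
  next
    case GF
    let ?g = "\<lambda>a. qint q (int n - int a) * d a * v (wt (Suc a)) * w (wt (n - a))"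
    have "form (gen_act q hw GF v) w = (\<Sum>a<n. ?g a)"
      unfolding form_def using w
      by (simp add: gen_act_vec) (rule S', auto simp: gen_act_wt)
    also have "\<dots> = form v (gen_act q hw GK (gen_act q hw GF w))"
    proof -
      \<comment> \<open>The recursion \<open>d_Suc\<close> that gave E-invariance serves again; its
        power of q cancels against the one from K.\<close>
      have "d (Suc a) * v (wt (Suc a)) * gen_act q hw GK (gen_act q hw GF w) (wt (n - Suc a)) = ?g a"
        if "a < n" for a
      proof -
        have na: "n - a = Suc (n - Suc a)" using that by simp
        have "gen_act q hw GK (gen_act q hw GF w) (wt (n - Suc a)) =
           q powi (- (2 * int a + 2 - int n)) * (qint q (int a + 1) * w (wt (n - a)))"
          unfolding na using that by (simp add: gen_act_wt of_nat_diff) (simp add: algebra_simps)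
        hence "d (Suc a) * v (wt (Suc a)) * gen_act q hw GK (gen_act q hw GF w) (wt (n - Suc a)) =
          (qint q (int a + 1) * d (Suc a)) * q powi (- (2 * int a + 2 - int n)) * v (wt (Suc a)) * w (wt (n - a))"
          by simp
        also have "\<dots> = (q powi (2 * int a + 2 - int n) * q powi (- (2 * int a + 2 - int n))) * ?g a"
          unfolding d_Suc[OF that] by simp
        also have "q powi (2 * int a + 2 - int n) * q powi (- (2 * int a + 2 - int n)) = 1"
          by (subst power_int_add[symmetric]) (use q_nz in auto)
        finally show ?thesis by simp
      qed
      thus ?thesis unfolding form_def using v
        by (simp add: gen_act_vec) (rule S[symmetric], auto simp: gen_act_wt)
    qed
    finally show ?thesis using GF by (simp add: anti_tau_simps free_act_simps)
  qed
qed

text \<open>Invariance passes to products because \<open>anti_tau\<close> reverses factors: first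
  \<open>p\<close>, then \<open>r\<close> is moved across the form. The vectors change on the way
  and so stay arbitrary in the induction.\<close>

lemma form_invariant: "invariant form"
proof -
  note lin = linear_maps_dualD[OF form_linear]
  have "form (free_act q hw p v) w = form v (free_act q hw (anti_tau p) w)"
    if "v \<in> vec V" "w \<in> vec V" for p v w
    using that
  proof (induction p arbitrary: v w rule: free_induct)
    case (const c)
    thus ?case by (simp only: anti_tau_simps free_act_const lin)
  next
    case (gen x)
    thus ?case using form_gen by (simp only: free_act_gen)
  next
    case (add p r)
    thus ?case by (simp only: anti_tau_simps free_act_add free_act_vec lin)
  next
    case (mult p r)
    thus ?case by (simp only: anti_tau_simps free_act_mult free_act_vec)
  qed
  thus ?thesis by (simp add: invariant_def)
qed

section \<open>Uniqueness of the invariant form up to scalars\<close>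

lemma invariant_multiple:
  assumes f: "f \<in> linear_maps V (sharp q \<tau> V)" and inv: "invariant f"
  shows "f = (\<lambda>v w. f (e 0) (e n) / d 0 * form v w)"
proof -
  note f' = linear_maps_dualD[OF f]
  have g: "f (gen_act q hw x v) w = f v (free_act q hw (anti_tau (gen x)) w)"
    if "v \<in> vec V" "w \<in> vec V" for x v w
    using inv that unfolding invariant_def by (metis free_act_gen)
  \<comment> \<open>K-invariance compares the exponents 2a - n and n - 2b, which agree only for a +
    b = n; different exponents give different powers of q.\<close>
  have off: "f (e a) (e b) = 0" if "a \<le> n" "b \<le> n" "a + b \<noteq> n" for a b
  proof -
    have "q powi (2 * int a - int n) * f (e a) (e b) = q powi (int n - 2 * int b) * f (e a) (e b)"
      using g[OF e_vec e_vec, of GK a b] that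
      by (simp add: gen_act_e e_vec anti_tau_simps free_act_simps f')
    moreover have "q powi (2 * int a - int n) \<noteq> q powi (int n - 2 * int b)"
    proof
      assume "q powi (2 * int a - int n) = q powi (int n - 2 * int b)"
      hence "q powi ((2 * int a - int n) - (int n - 2 * int b)) = 1"
        using q_nz by (subst power_int_diff) auto
      thus False using that unfolding powi_eq_1 by linarith
    qed
    ultimately show ?thesis by simp
  qed
  have diag: "f (e a) (e (n - a)) = f (e 0) (e n) / d 0 * d a" if "a \<le> n" for a
    using that
  proof (induction a)
    case 0
    show ?case using d_nz by simp
  next
    case (Suc a)
    hence a: "a < n" by simp
    hence na: "Suc (n - Suc a) = n - a" by simp
    have i: "int (n - Suc a) + 1 = int n - int a" "int n - 2 * int (n - Suc a) = 2 * int a + 2 - int n"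
      using a by (simp_all add: of_nat_diff)
    \<comment> \<open>The indices a and n - a - 1 sum to n - 1, so raising either vector by E gives
      a pair summing to n. E-invariance thus links neighbouring diagonal values.\<close>
    have "qint q (int a + 1) * f (e (Suc a)) (e (n - Suc a))
        = q powi (2 * int a + 2 - int n) * qint q (int n - int a) * f (e a) (e (n - a))"
      using g[OF e_vec e_vec, of GE a "n - Suc a"] a
      by (simp add: gen_act_e e_vec anti_tau_simps free_act_simps gen_act_scale vec_closed f' i na)
        (simp add: add_ac)
    also have "\<dots> = qint q (int a + 1) * (f (e 0) (e n) / d 0 * d (Suc a))"
      using d_Suc[OF a] Suc by (simp add: mult_ac)
    finally show ?case
      by (rule mult_left_cancel[THEN iffD1, OF qint_nz, rotated]) simp
  qed
  show ?thesis
  proof (intro ext)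
    fix v w
    show "f v w = f (e 0) (e n) / d 0 * form v w"
    proof (cases "v \<in> vec V \<and> w \<in> vec V")
      case True
      have "f v w = (\<Sum>a\<le>n. \<Sum>b\<le>n. v (wt a) * w (wt b) * f (e a) (e b))"
        using True by (intro bilinear_expand[OF f]) auto
      also have "\<dots> = (\<Sum>a\<le>n. \<Sum>b\<le>n. if b = n - a then v (wt a) * w (wt b) * f (e a) (e b) else 0)"
        by (intro sum.cong refl) (auto simp: off)
      also have "\<dots> = (\<Sum>a\<le>n. v (wt a) * w (wt (n - a)) * (f (e 0) (e n) / d 0 * d a))"
        by (intro sum.cong refl) (simp add: diag)
      finally show ?thesis using True by (simp add: form_def sum_distrib_left mult_ac)
    next
      case False
      thus ?thesis using f' by (auto simp: form_def)
    qed
  qed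
qed

section \<open>From invariant forms to the trace\<close>

lemma hw_int: "2 * hw \<in> \<int>" by (simp add: hw_def)

text \<open>Every element of \<open>Uq q\<close> is the class of some \<open>p\<close>, and both
  actions can be computed on representatives.\<close>

lemma module_hom_sharp_iff:
  assumes \<tau>: "\<And>p. \<tau> (uq_class q p) = uq_class q (ftau p)"
  shows "f \<in> vec (module_hom_space q V (sharp q \<tau> V)) \<longleftrightarrow>
    f \<in> linear_maps V (sharp q \<tau> V) \<and> invariant f"
proof -
  note act = act_Vmod_class[OF q_nz q_diff hw_int]
  have *: "f (act V (uq_class q p) v) = act (sharp q \<tau> V) (uq_class q p) (f v) \<longleftrightarrow>
      (\<forall>w\<in>vec V. f (free_act q hw p v) w = f v (free_act q hw (anti_tau p) w))"
    if f: "f \<in> linear_maps V (sharp q \<tau> V)" and v: "v \<in> vec V" for p v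
  proof -
    \<comment> \<open>Functionals are compared on all vectors, and outside \<open>V\<close> both
      sides are zero by convention.\<close>
    have "f (free_act q hw p v) w = 0" if "w \<notin> vec V" for w
      using f that by (simp add: linear_maps_dual_iff)
    moreover have "act (sharp q \<tau> V) (uq_class q p) (f v) =
      (\<lambda>w. if w \<in> vec V then f v (free_act q hw (anti_tau p) w) else 0)"
      by (auto simp: sharp_def \<tau> uq_antipode_class[OF q_nz] act fun_eq_iff)
    ultimately show ?thesis by (auto simp: act v fun_eq_iff)
  qed
  show ?thesis
    by (auto simp: module_hom_space_def invariant_def carrier_Uq *)
qed

lemma transpose_double_sharp:
  assumes f: "f \<in> linear_maps V (sharp q \<tau> V)"
  shows "(transpose_map V (sharp q \<tau> V) f \<circ> double_sharp_map q \<tau> V) v w =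
    (if v \<in> vec V \<and> w \<in> vec V then f w (gen_act q hw GK v) else 0)"
proof (cases "v \<in> vec V")
  case False
  thus ?thesis by (simp add: double_sharp_map_def transpose_map_def)
next
  case True
  have K: "act V (uqK q) v = gen_act q hw GK v"
    using act_Vmod_class[OF q_nz q_diff hw_int True] by (simp add: free_act_gen)
  have j: "double_sharp_map q \<tau> V v =
      (\<lambda>\<phi>. if \<phi> \<in> vec (sharp q \<tau> V) then \<phi> (gen_act q hw GK v) else 0)"
    using True by (auto simp: double_sharp_map_def K fun_eq_iff)
  \<comment> \<open>\<open>transpose_map\<close> returns zero on anything that is not a functional,
    so membership comes before evaluation.\<close>
  have "double_sharp_map q \<tau> V v \<in> vec (dual_space (sharp q \<tau> V))"
    unfolding j
    by (auto simp: dual_space_def sharp_def linear_maps_def ground_def algebra_simps)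
  moreover have "w \<in> vec V \<Longrightarrow> f w \<in> vec (sharp q \<tau> V)"
    using f by (simp add: linear_maps_def)
  ultimately show ?thesis using True by (simp add: transpose_map_def j)
qed

text \<open>The homomorphisms form the line through \<open>form\<close>, on which the operator is
  the identity by \<open>form_K\<close>.\<close>

theorem twisted_indicator_eq_1:
  assumes \<tau>: "\<And>p. \<tau> (uq_class q p) = uq_class q (ftau p)"
  shows "twisted_indicator q \<tau> V = 1"
  unfolding twisted_indicator_def
proof (rule space_trace_line)
  let ?H = "module_hom_space q V (sharp q \<tau> V)"
  let ?T = "\<lambda>f. transpose_map V (sharp q \<tau> V) f \<circ> double_sharp_map q \<tau> V"
  have smul: "smul ?H = (\<lambda>c f v w. c * f v w)"
    by (simp add: module_hom_space_def sharp_def dual_space_def)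
  show "vector_space (smul ?H)"
    unfolding smul by unfold_locales (auto simp: fun_eq_iff algebra_simps)
  note H = module_hom_sharp_iff[of \<tau>, OF \<tau>]
  have mem: "(\<lambda>v w. c * form v w) \<in> vec ?H" for c
  proof -
    have "(\<lambda>v w. c * form v w) \<in> linear_maps V (sharp q \<tau> V)"
      using form_linear[of \<tau>] unfolding linear_maps_dual_iff by (simp add: algebra_simps)
    moreover have "invariant (\<lambda>v w. c * form v w)"
      using form_invariant by (simp add: invariant_def)
    ultimately show ?thesis by (simp add: H)
  qed
  show range: "vec ?H = range (\<lambda>c. smul ?H c form)"
  proof (intro equalityI subsetI)
    fix f assume "f \<in> vec ?H"
    from invariant_multiple[OF this[unfolded H, THEN conjunct1] this[unfolded H, THEN conjunct2]]
    show "f \<in> range (\<lambda>c. smul ?H c form)" unfolding smul by blast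
  qed (use mem in \<open>auto simp: smul\<close>)
  show "form \<noteq> 0" by (rule form_nz)
  fix f assume f: "f \<in> vec ?H"
  then obtain c where c: "f = (\<lambda>v w. c * form v w)" unfolding range smul by blast
  have lin: "f \<in> linear_maps V (sharp q \<tau> V)" using f by (simp add: H)
  show "?T f = f"
  proof (intro ext)
    fix v w
    show "?T f v w = f v w"
      \<comment> \<open>Inside \<open>V\<close> this is \<open>form_K\<close>; outside,
        \<open>form\<close> itself vanishes.\<close>
      unfolding transpose_double_sharp[OF lin] by (auto simp: c form_K) (auto simp: form_def)
  qed
qed

end

theorem theorem5p5:
  fixes q :: "'k::{alg_closed_field, field_char_0}"
    and \<tau> :: "'k free set \<Rightarrow> 'k free set"
    and l :: rat
  assumes "q \<noteq> 0"
    and "\<And>n::nat. n > 0 \<Longrightarrow> q ^ n \<noteq> 1"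
    and "hopf_automorphism q \<tau>"
    and "\<And>u. u \<in> carrier (Uq q) \<Longrightarrow> \<tau> (\<tau> u) = u"
    and "\<tau> (uqE q) = \<ominus>\<^bsub>Uq q\<^esub> uqE q"
    and "\<tau> (uqF q) = \<ominus>\<^bsub>Uq q\<^esub> uqF q"
    and "\<tau> (uqK q) = uqK q"
    and "2 * l \<in> \<nat>"
  shows "twisted_indicator q \<tau> (Vmod q l) = 1"
proof -
  \<comment> \<open>With n = 2l the weight \<open>hw\<close> of the locale is l.\<close>
  obtain n :: nat where n: "2 * l = of_nat n" using assms(8) by (auto elim: Nats_cases)
  interpret generic_weight_module q n by unfold_locales (use assms in auto)
  have l: "l = hw" using n by (simp add: hw_def)
  show ?thesis unfolding l
    by (rule twisted_indicator_eq_1, rule hopf_automorphism_class[OF assms(3,5,6,7)])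
qed

end
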